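(* The numerical range $W(\mathcal L)$ is contained in the subset of $\mathbb C$ described by the inequality $$0\le-\operatorname{Im}\omega\le\min\Big(M,\ \frac{\gamma_e\|\theta_e\|_\infty^2+\gamma_m\|\theta_m\|_\infty^2}{(\operatorname{Re}\omega)^2}\Big),\qquad M=\max\{\gamma_e,\gamma_m\},$$ where the minimum is understood to be $M$ when $\operatorname{Re}\omega=0$.
   Context: $\Omega\subseteq\mathbb R^3$ is a (bounded or unbounded) Lipschitz domain; $\gamma_e,\gamma_m>0$ are constants; $\theta_e,\theta_m\in L^\infty(\Omega)$ are real-valued and non-negative, identified with multiplication operators. $H(\operatorname{curl},\Omega)=\{u\in L^2(\Omega)^3:\operatorname{curl}u\in L^2(\Omega)^3\}$ with its graph norm; $H_0(\operatorname{curl},\Omega)$ is the closure of $C_c^\infty(\Omega)^3$ in it; $\operatorname{curl}$ has domain $H(\operatorname{curl},\Omega)$ and $\operatorname{curl}_0$ is its restriction to $H_0(\operatorname{curl},\Omega)$. For $\omega\in\mathbb C\setminus\{-i\gamma_e,-i\gamma_m\}$, $$\mathcal L(\omega)=\begin{pmatrix}-\omega+\frac{\theta_e^2}{\omega+i\gamma_e}& i\operatorname{curl}\\ -i\operatorname{curl}_0&-\omega+\frac{\theta_m^2}{\omega+i\gamma_m}\end{pmatrix},\quad \operatorname{dom}\mathcal L(\omega)=H_0(\operatorname{curl},\Omega)\oplus H(\operatorname{curl},\Omega)\subset L^2(\Omega)^3\oplus L^2(\Omega)^3.$$ For an operator $T$, $W(T)=\{(Tu,u):u\in\operatorname{dom}T,\|u\|=1\}$.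 For the pencil, $W(\mathcal L)=\{\omega\in\mathbb C\setminus\{-i\gamma_e,-i\gamma_m\}:0\in\overline{W(\mathcal L(\omega))}\}$. *)

theory Defs
  imports "HOL-Analysis.Analysis" "HOL-Probability.Essential_Supremum"
begin

type_synonym vfield = "real^3 \<Rightarrow> complex^3"

(* Local graph condition at every boundary point: in suitable orthonormal coordinates centred at p,
   the set is the part of a ball above the graph of a Lipschitz function.  No uniformity of the
   radii or of the Lipschitz constants is required, and the domain may be unbounded. *)
definition lipschitz_domain :: "(real^3) set \<Rightarrow> bool" where
  "lipschitz_domain \<Omega> \<longleftrightarrow> open \<Omega> \<and> connected \<Omega> \<and> \<Omega> \<noteq> {} \<and>
     (\<forall>p \<in> frontier \<Omega>. \<exists>r > 0. \<exists>T :: real^3 \<Rightarrow> real^3. \<exists>g :: real^2 \<Rightarrow> real. \<exists>L.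
        orthogonal_transformation T \<and> lipschitz_on L UNIV g \<and>
        (\<forall>x \<in> ball p r. x \<in> \<Omega> \<longleftrightarrow>
           T (x - p) $ 3 > g (vector [T (x - p) $ 1, T (x - p) $ 2])))"

primrec C_diff :: "nat \<Rightarrow> vfield \<Rightarrow> bool" where
  "C_diff 0 f \<longleftrightarrow> continuous_on UNIV f"
| "C_diff (Suc k) f \<longleftrightarrow> (\<forall>x. f differentiable (at x)) \<and>
     (\<forall>v. C_diff k (\<lambda>x. frechet_derivative f (at x) v))"

definition test_fields :: "(real^3) set \<Rightarrow> vfield set" where
  "test_fields \<Omega> = {\<phi>. (\<forall>k. C_diff k \<phi>) \<and>
     compact (closure {x. \<phi> x \<noteq> 0}) \<and> closure {x. \<phi> x \<noteq> 0} \<subseteq> \<Omega>}"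

definition pderiv_comp :: "3 \<Rightarrow> 3 \<Rightarrow> vfield \<Rightarrow> real^3 \<Rightarrow> complex" where
  "pderiv_comp i j \<phi> x = frechet_derivative \<phi> (at x) (axis i 1) $ j"

definition classical_curl :: "vfield \<Rightarrow> vfield" where
  "classical_curl \<phi> x = vector
     [pderiv_comp 2 3 \<phi> x - pderiv_comp 3 2 \<phi> x,
      pderiv_comp 3 1 \<phi> x - pderiv_comp 1 3 \<phi> x,
      pderiv_comp 1 2 \<phi> x - pderiv_comp 2 1 \<phi> x]"

(* Elements of L2 are represented by functions; all notions below depend only on their values
   almost everywhere in the domain. *)
definition L2_fields :: "(real^3) set \<Rightarrow> vfield set" where
  "L2_fields \<Omega> = {u. u \<in> borel_measurable (lebesgue_on \<Omega>) \<and>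
     integrable (lebesgue_on \<Omega>) (\<lambda>x. (norm (u x))\<^sup>2)}"

definition L2_inner :: "(real^3) set \<Rightarrow> vfield \<Rightarrow> vfield \<Rightarrow> complex" where
  "L2_inner \<Omega> u v = (LINT x|lebesgue_on \<Omega>. (\<Sum>j\<in>UNIV. u x $ j * cnj (v x $ j)))"

definition L2_norm :: "(real^3) set \<Rightarrow> vfield \<Rightarrow> real" where
  "L2_norm \<Omega> u = sqrt (Re (L2_inner \<Omega> u u))"

(* Distributional curl.  Testing with the conjugate of phi is immaterial, since the space of test
   fields is closed under complex conjugation. *)
definition is_weak_curl :: "(real^3) set \<Rightarrow> vfield \<Rightarrow> vfield \<Rightarrow> bool" where
  "is_weak_curl \<Omega> u w \<longleftrightarrow>
     (\<forall>\<phi> \<in> test_fields \<Omega>. L2_inner \<Omega> w \<phi> = L2_inner \<Omega> u (classical_curl \<phi>))"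

definition H_curl :: "(real^3) set \<Rightarrow> vfield set" where
  "H_curl \<Omega> = {u \<in> L2_fields \<Omega>. \<exists>w \<in> L2_fields \<Omega>. is_weak_curl \<Omega> u w}"

(* Meaningful on H_curl; the weak curl is unique up to null sets, so the choice of representative
   does not affect any inner product or norm. *)
definition curl :: "(real^3) set \<Rightarrow> vfield \<Rightarrow> vfield" where
  "curl \<Omega> u = (SOME w. w \<in> L2_fields \<Omega> \<and> is_weak_curl \<Omega> u w)"

definition curl_graph_norm :: "(real^3) set \<Rightarrow> vfield \<Rightarrow> real" where
  "curl_graph_norm \<Omega> u = sqrt ((L2_norm \<Omega> u)\<^sup>2 + (L2_norm \<Omega> (curl \<Omega> u))\<^sup>2)"

definition H0_curl :: "(real^3) set \<Rightarrow> vfield set" where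
  "H0_curl \<Omega> = {u \<in> H_curl \<Omega>.
     \<forall>\<epsilon> > 0. \<exists>\<phi> \<in> test_fields \<Omega>. curl_graph_norm \<Omega> (\<lambda>x. u x - \<phi> x) < \<epsilon>}"

definition Linf_norm :: "(real^3) set \<Rightarrow> (real^3 \<Rightarrow> real) \<Rightarrow> real" where
  "Linf_norm \<Omega> \<theta> = real_of_ereal (esssup (lebesgue_on \<Omega>) (\<lambda>x. ereal \<bar>\<theta> x\<bar>))"

definition Linf :: "(real^3) set \<Rightarrow> (real^3 \<Rightarrow> real) set" where
  "Linf \<Omega> = {\<theta>. \<theta> \<in> borel_measurable (lebesgue_on \<Omega>) \<and>
     esssup (lebesgue_on \<Omega>) (\<lambda>x. ereal \<bar>\<theta> x\<bar>) < \<infinity>}"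

(* Numerical range of an operator T with domain D in the space with inner product ip
   (linear in the first argument). *)
definition numerical_range :: "('a \<Rightarrow> 'a \<Rightarrow> complex) \<Rightarrow> 'a set \<Rightarrow> ('a \<Rightarrow> 'a) \<Rightarrow> complex set" where
  "numerical_range ip D T = {ip (T u) u | u. u \<in> D \<and> sqrt (Re (ip u u)) = 1}"

definition L2_pair_inner ::
  "(real^3) set \<Rightarrow> vfield \<times> vfield \<Rightarrow> vfield \<times> vfield \<Rightarrow> complex" where
  "L2_pair_inner \<Omega> U V = L2_inner \<Omega> (fst U) (fst V) + L2_inner \<Omega> (snd U) (snd V)"

definition maxwell_dom :: "(real^3) set \<Rightarrow> (vfield \<times> vfield) set" where
  "maxwell_dom \<Omega> = H0_curl \<Omega> \<times> H_curl \<Omega>"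

(* On maxwell_dom the curl applied to the first component u is curl_0, since u is in H0_curl. *)
definition maxwell_pencil ::
  "(real^3) set \<Rightarrow> real \<Rightarrow> real \<Rightarrow> (real^3 \<Rightarrow> real) \<Rightarrow> (real^3 \<Rightarrow> real) \<Rightarrow> complex \<Rightarrow>
   vfield \<times> vfield \<Rightarrow> vfield \<times> vfield" where
  "maxwell_pencil \<Omega> \<gamma>e \<gamma>m \<theta>e \<theta>m \<omega> = (\<lambda>(u, v).
     (\<lambda>x. (- \<omega> + of_real ((\<theta>e x)\<^sup>2) / (\<omega> + \<i> * of_real \<gamma>e)) *s u x + \<i> *s curl \<Omega> v x,
      \<lambda>x. (- \<i>) *s curl \<Omega> u x + (- \<omega> + of_real ((\<theta>m x)\<^sup>2) / (\<omega> + \<i> * of_real \<gamma>m)) *s v x))"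

definition pencil_numerical_range ::
  "(real^3) set \<Rightarrow> real \<Rightarrow> real \<Rightarrow> (real^3 \<Rightarrow> real) \<Rightarrow> (real^3 \<Rightarrow> real) \<Rightarrow> complex set" where
  "pencil_numerical_range \<Omega> \<gamma>e \<gamma>m \<theta>e \<theta>m =
     {\<omega>. \<omega> \<notin> {- \<i> * of_real \<gamma>e, - \<i> * of_real \<gamma>m} \<and>
        0 \<in> closure (numerical_range (L2_pair_inner \<Omega>) (maxwell_dom \<Omega>)
                      (maxwell_pencil \<Omega> \<gamma>e \<gamma>m \<theta>e \<theta>m \<omega>))}"

end

theory Submission
  imports Defs
begin

text \<open>
  On \<open>H\<^sub>0(curl) \<times> H(curl)\<close> the two curl entries of the pencil are adjoint to each other, so they contribute a
  real number to the quadratic form and only the diagonal entries enter its imaginary part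
  \<open>- Im \<omega> - \<Sum>\<^sub>j A\<^sub>j (Im \<omega> + \<gamma>\<^sub>j) / \<bar>\<omega> + i \<gamma>\<^sub>j\<bar>\<^sup>2\<close>, where
  \<open>0 \<le> A\<^sub>j \<le> \<parallel>\<theta>\<^sub>j\<parallel>\<^sub>\<infinity>\<^sup>2\<close>. If \<open>\<omega>\<close> is in the numerical range this can be made arbitrarily small; comparing signs gives
  \<open>0 \<le> - Im \<omega> \<le> M\<close>, and \<open>(Im \<omega> + \<gamma>) / \<bar>\<omega> + i \<gamma>\<bar>\<^sup>2 \<le> \<gamma> / (Re \<omega>)\<^sup>2\<close> gives the remaining bound.

  The definition of \<open>H\<^sub>0(curl)\<close> measures \<open>curl (u - \<phi>)\<close> through an arbitrarily chosen weak curl, so adjointness also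
  needs integration by parts for test fields and the almost everywhere uniqueness of weak curls.
\<close>

subsection \<open>Square integrable fields\<close>

text \<open>Pointwise Cauchy-Schwarz: the triangle inequality reduces it to the real inequality for
  the moduli of the components.\<close>

lemma sum_mult_cnj_bound:
  fixes a b :: "complex^'n"
  shows "norm (\<Sum>j\<in>UNIV. a $ j * cnj (b $ j)) \<le> norm a * norm b"
proof -
  have "norm (\<Sum>j\<in>UNIV. a $ j * cnj (b $ j)) \<le> (\<Sum>j\<in>UNIV. \<bar>norm (a $ j)\<bar> * \<bar>norm (b $ j)\<bar>)"
    by (rule sum_norm_le) (simp add: norm_mult)
  also have "\<dots> \<le> norm a * norm b"
    unfolding norm_vec_def by (rule L2_set_mult_ineq)
  finally show ?thesis .
qed

lemma sum_mult_cnj_self: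
  fixes a :: "complex^'n"
  shows "(\<Sum>j\<in>UNIV. a $ j * cnj (a $ j)) = of_real ((norm a)\<^sup>2)"
  by (simp add: norm_vec_def L2_set_def complex_norm_square sum_nonneg del: of_real_power)

lemma measurable_sum_mult_cnj [measurable]:
  fixes u v :: "'a \<Rightarrow> complex^'n"
  assumes [measurable]: "u \<in> borel_measurable M" "v \<in> borel_measurable M"
  shows "(\<lambda>x. \<Sum>j\<in>UNIV. u x $ j * cnj (v x $ j)) \<in> borel_measurable M"
  by (rule borel_measurable_continuous_Pair [OF assms]) (auto intro!: continuous_intros)

lemma L2_fieldsD:
  assumes "u \<in> L2_fields \<Omega>"
  shows "u \<in> borel_measurable (lebesgue_on \<Omega>)"
    and "integrable (lebesgue_on \<Omega>) (\<lambda>x. (norm (u x))\<^sup>2)"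
  using assms by (auto simp: L2_fields_def)

lemma L2_fields_bounded_by:
  assumes "u \<in> borel_measurable (lebesgue_on \<Omega>)" "integrable (lebesgue_on \<Omega>) g"
    and "AE x in lebesgue_on \<Omega>. (norm (u x))\<^sup>2 \<le> g x"
  shows "u \<in> L2_fields \<Omega>"
proof -
  have "integrable (lebesgue_on \<Omega>) (\<lambda>x. (norm (u x))\<^sup>2)"
    by (rule Bochner_Integration.integrable_bound[OF assms(2)])
       (use assms in \<open>auto elim!: eventually_mono\<close>)
  then show ?thesis using assms by (simp add: L2_fields_def)
qed

lemma L2_fields_add:
  assumes "u \<in> L2_fields \<Omega>" "v \<in> L2_fields \<Omega>"
  shows "(\<lambda>x. u x + v x) \<in> L2_fields \<Omega>"
proof (rule L2_fields_bounded_by)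
  show "integrable (lebesgue_on \<Omega>) (\<lambda>x. 2 * (norm (u x))\<^sup>2 + 2 * (norm (v x))\<^sup>2)"
    using L2_fieldsD assms by auto
  have "(norm (u x + v x))\<^sup>2 \<le> 2 * (norm (u x))\<^sup>2 + 2 * (norm (v x))\<^sup>2" for x
  proof -
    have "(norm (u x + v x))\<^sup>2 \<le> (norm (u x) + norm (v x))\<^sup>2"
      by (intro power_mono norm_triangle_ineq) auto
    also have "\<dots> \<le> 2 * (norm (u x))\<^sup>2 + 2 * (norm (v x))\<^sup>2"
      using zero_le_power2[of "norm (u x) - norm (v x)"] by (simp add: power2_eq_square algebra_simps)
    finally show ?thesis .
  qed
  then show "AE x in lebesgue_on \<Omega>. (norm (u x + v x))\<^sup>2 \<le> 2 * (norm (u x))\<^sup>2 + 2 * (norm (v x))\<^sup>2"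
    by simp
qed (use L2_fieldsD assms in \<open>auto intro!: borel_measurable_add\<close>)

lemma norm_vector_scalar_mult:
  fixes a :: "complex^'n"
  shows "norm (c *s a) = norm c * norm a"
  by (simp add: norm_vec_def L2_set_def norm_mult power_mult_distrib real_sqrt_mult
      flip: sum_distrib_left)

text \<open>The dominating function is \<open>B\<^sup>2\<close> times the squared norm of
  \<open>u\<close>. Meant for the multiplier \<open>\<theta>\<^sup>2\<close>, which is bounded only
  almost everywhere, and for constant scalars.\<close>

lemma L2_fields_mult:
  assumes [measurable]: "c \<in> borel_measurable (lebesgue_on \<Omega>)"
    and c: "AE x in lebesgue_on \<Omega>. norm (c x) \<le> B" and u: "u \<in> L2_fields \<Omega>"
  shows "(\<lambda>x. c x *s u x) \<in> L2_fields \<Omega>"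
proof (rule L2_fields_bounded_by)
  have [measurable]: "u \<in> borel_measurable (lebesgue_on \<Omega>)" using u L2_fieldsD by auto
  show "(\<lambda>x. c x *s u x) \<in> borel_measurable (lebesgue_on \<Omega>)"
  proof -
    have "continuous_on UNIV (\<lambda>p :: complex \<times> (complex^3). fst p *s snd p)"
      unfolding vector_scalar_mult_def by (intro continuous_on_vec_lambda continuous_intros)
    then show ?thesis
      by (intro borel_measurable_continuous_Pair[where H="\<lambda>a b. a *s b"]) (auto simp: case_prod_beta)
  qed
  show "integrable (lebesgue_on \<Omega>) (\<lambda>x. B\<^sup>2 * (norm (u x))\<^sup>2)"
    using L2_fieldsD u by auto
  show "AE x in lebesgue_on \<Omega>. (norm (c x *s u x))\<^sup>2 \<le> B\<^sup>2 * (norm (u x))\<^sup>2"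
    using c by eventually_elim
      (auto simp: norm_vector_scalar_mult power_mult_distrib intro!: mult_right_mono power_mono)
qed

lemma L2_fields_scale: "u \<in> L2_fields \<Omega> \<Longrightarrow> (\<lambda>x. c *s u x) \<in> L2_fields \<Omega>"
  by (rule L2_fields_mult[where B = "norm c"]) auto

lemma L2_fields_diff:
  assumes "u \<in> L2_fields \<Omega>" "v \<in> L2_fields \<Omega>"
  shows "(\<lambda>x. u x - v x) \<in> L2_fields \<Omega>"
proof -
  have "(-1 :: complex) *s a = - a" for a :: "complex^3"
    by (simp add: vec_eq_iff)
  then show ?thesis
    using L2_fields_add[OF assms(1) L2_fields_scale[OF assms(2), of "-1"]] by simp
qed

lemma L2_inner_integrable:
  assumes "u \<in> L2_fields \<Omega>" "v \<in> L2_fields \<Omega>"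
  shows "integrable (lebesgue_on \<Omega>) (\<lambda>x. \<Sum>j\<in>UNIV. u x $ j * cnj (v x $ j))"
proof (rule Bochner_Integration.integrable_bound)
  show "integrable (lebesgue_on \<Omega>) (\<lambda>x. (norm (u x))\<^sup>2 + (norm (v x))\<^sup>2)"
    using L2_fieldsD assms by auto
  have "norm (\<Sum>j\<in>UNIV. u x $ j * cnj (v x $ j)) \<le> (norm (u x))\<^sup>2 + (norm (v x))\<^sup>2" for x
  proof -
    have "norm (u x) * norm (v x) \<le> (norm (u x))\<^sup>2 + (norm (v x))\<^sup>2"
      using sum_squares_bound[of "norm (u x)" "norm (v x)"]
        mult_nonneg_nonneg[OF norm_ge_zero norm_ge_zero, of "u x" "v x"] by linarith
    then show ?thesis using sum_mult_cnj_bound[of "u x" "v x"] by linarith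
  qed
  then show "AE x in lebesgue_on \<Omega>. norm (\<Sum>j\<in>UNIV. u x $ j * cnj (v x $ j))
      \<le> norm ((norm (u x))\<^sup>2 + (norm (v x))\<^sup>2)"
    by simp
qed (use L2_fieldsD assms in auto)

lemma L2_inner_add_left:
  assumes "u \<in> L2_fields \<Omega>" "v \<in> L2_fields \<Omega>" "w \<in> L2_fields \<Omega>"
  shows "L2_inner \<Omega> (\<lambda>x. u x + v x) w = L2_inner \<Omega> u w + L2_inner \<Omega> v w"
  unfolding L2_inner_def
  by (subst Bochner_Integration.integral_add[symmetric])
     (auto simp: L2_inner_integrable assms algebra_simps sum.distrib)

lemma L2_inner_diff_left:
  assumes "u \<in> L2_fields \<Omega>" "v \<in> L2_fields \<Omega>" "w \<in> L2_fields \<Omega>"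
  shows "L2_inner \<Omega> (\<lambda>x. u x - v x) w = L2_inner \<Omega> u w - L2_inner \<Omega> v w"
  unfolding L2_inner_def
  by (subst Bochner_Integration.integral_diff[symmetric])
     (auto simp: L2_inner_integrable assms algebra_simps sum_subtractf)

lemma L2_inner_scale_left: "L2_inner \<Omega> (\<lambda>x. c *s u x) w = c * L2_inner \<Omega> u w"
  unfolding L2_inner_def
  by (simp add: mult.assoc flip: sum_distrib_left)

lemma L2_inner_commute: "L2_inner \<Omega> u v = cnj (L2_inner \<Omega> v u)"
  proof -
  have "cnj (L2_inner \<Omega> v u) = (LINT x|lebesgue_on \<Omega>. cnj (\<Sum>j\<in>UNIV. v x $ j * cnj (u x $ j)))"
    unfolding L2_inner_def by (rule Bochner_Integration.integral_cnj[symmetric])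
  then show ?thesis unfolding L2_inner_def by (simp add: mult.commute)
qed

lemma L2_inner_diff_right:
  assumes "u \<in> L2_fields \<Omega>" "v \<in> L2_fields \<Omega>" "w \<in> L2_fields \<Omega>"
  shows "L2_inner \<Omega> w (\<lambda>x. u x - v x) = L2_inner \<Omega> w u - L2_inner \<Omega> w v"
  using L2_inner_diff_left[OF assms] L2_inner_commute complex_cnj_diff by metis

lemma L2_inner_self: "L2_inner \<Omega> u u = of_real ((L2_norm \<Omega> u)\<^sup>2)"
proof -
  have "L2_inner \<Omega> u u = of_real (LINT x|lebesgue_on \<Omega>. (norm (u x))\<^sup>2)"
    unfolding L2_inner_def sum_mult_cnj_self by (rule integral_complex_of_real)
  moreover have "0 \<le> (LINT x|lebesgue_on \<Omega>. (norm (u x))\<^sup>2)" by simp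
  ultimately show ?thesis unfolding L2_norm_def by simp
qed

lemma L2_norm_nonneg: "0 \<le> L2_norm \<Omega> u"
proof -
  have "L2_inner \<Omega> u u = of_real (LINT x|lebesgue_on \<Omega>. (norm (u x))\<^sup>2)"
    unfolding L2_inner_def sum_mult_cnj_self by (rule integral_complex_of_real)
  then show ?thesis unfolding L2_norm_def by simp
qed

lemma L2_norm_sq: "(L2_norm \<Omega> u)\<^sup>2 = (LINT x|lebesgue_on \<Omega>. (norm (u x))\<^sup>2)"
  using L2_inner_self[of \<Omega> u] unfolding L2_inner_def sum_mult_cnj_self integral_complex_of_real
  by (metis of_real_eq_iff)

text \<open>Integrating the weighted inequality 2 s |u| |v| \<le> |u|^2 + s^2 |v|^2 and choosing the
  best weight \<open>s\<close> gives the product of the norms.\<close>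

lemma L2_Cauchy_Schwarz:
  assumes "u \<in> L2_fields \<Omega>" "v \<in> L2_fields \<Omega>"
  shows "norm (L2_inner \<Omega> u v) \<le> L2_norm \<Omega> u * L2_norm \<Omega> v"
proof -
  let ?I = "L2_inner \<Omega> u v" and ?a = "L2_norm \<Omega> u" and ?b = "L2_norm \<Omega> v"
  have key: "2 * s * norm ?I \<le> ?a\<^sup>2 + s\<^sup>2 * ?b\<^sup>2" if "0 \<le> s" for s
  proof -
    have "2 * s * norm ?I \<le> 2 * s * (LINT x|lebesgue_on \<Omega>. norm (\<Sum>j\<in>UNIV. u x $ j * cnj (v x $ j)))"
      unfolding L2_inner_def using that by (intro mult_left_mono integral_norm_bound) auto
    also have "\<dots> = (LINT x|lebesgue_on \<Omega>. 2 * s * norm (\<Sum>j\<in>UNIV. u x $ j * cnj (v x $ j)))"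
      by simp
    also have "\<dots> \<le> (LINT x|lebesgue_on \<Omega>. (norm (u x))\<^sup>2 + s\<^sup>2 * (norm (v x))\<^sup>2)"
    proof (rule integral_mono)
      fix x
      have "2 * s * norm (\<Sum>j\<in>UNIV. u x $ j * cnj (v x $ j)) \<le> 2 * s * (norm (u x) * norm (v x))"
        using that by (intro mult_left_mono sum_mult_cnj_bound) auto
      also have "\<dots> \<le> (norm (u x))\<^sup>2 + s\<^sup>2 * (norm (v x))\<^sup>2"
        using zero_le_power2[of "norm (u x) - s * norm (v x)"]
        by (simp add: power2_eq_square algebra_simps)
      finally show "2 * s * norm (\<Sum>j\<in>UNIV. u x $ j * cnj (v x $ j))
          \<le> (norm (u x))\<^sup>2 + s\<^sup>2 * (norm (v x))\<^sup>2" .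
    qed (use L2_fieldsD assms L2_inner_integrable in auto)
    also have "\<dots> = ?a\<^sup>2 + s\<^sup>2 * ?b\<^sup>2"
      using L2_fieldsD assms by (simp add: L2_norm_sq)
    finally show ?thesis .
  qed
  \<comment> \<open>The best weight is the quotient of the norms. Enlarging both by \<open>e\<close>
    keeps it defined and positive when a norm vanishes; letting \<open>e\<close> tend to 0 removes
    the enlargement.\<close>
  have "norm ?I \<le> (?a + e) * (?b + e)" if "0 < e" for e
  proof -
    have pos: "0 < ?a + e" "0 < ?b + e"
      using that L2_norm_nonneg[of \<Omega> u] L2_norm_nonneg[of \<Omega> v] by linarith+
    define s where "s = (?a + e) / (?b + e)"
    have s: "0 < s" "s * (?b + e) = ?a + e" using pos by (auto simp: s_def)
    have "2 * s * norm ?I \<le> ?a\<^sup>2 + s\<^sup>2 * ?b\<^sup>2" using key s by simp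
    also have "\<dots> \<le> (?a + e)\<^sup>2 + s\<^sup>2 * (?b + e)\<^sup>2"
      using that by (intro add_mono mult_left_mono power_mono) (auto simp: L2_norm_nonneg)
    also have "\<dots> = 2 * s * ((?a + e) * (?b + e))"
      by (simp add: s(2)[symmetric] power2_eq_square)
    finally show ?thesis using s(1) by simp
  qed
  then have "\<forall>\<^sub>F e in at_right 0. norm ?I \<le> (?a + e) * (?b + e)"
    by (auto simp: eventually_at_right_field intro: exI[of _ 1])
  moreover have "((\<lambda>e. (?a + e) * (?b + e)) \<longlongrightarrow> (?a + 0) * (?b + 0)) (at_right 0)"
    by (intro tendsto_intros)
  ultimately show ?thesis
    by (intro tendsto_lowerbound[where F = "at_right (0::real)"]) auto
qed

subsection \<open>Integration by parts for test fields\<close>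

text \<open>The complement of \<open>K\<close> is open, so \<open>f\<close> is zero near
  \<open>x\<close>, and derivatives are unique.\<close>

lemma has_derivative_zero_outside:
  fixes f :: "'a::real_normed_vector \<Rightarrow> 'b::real_normed_vector"
  assumes "closed K" "\<And>x. x \<notin> K \<Longrightarrow> f x = 0" "x \<notin> K" "(f has_derivative f') (at x)"
  shows "f' = (\<lambda>_. 0)"
proof -
  have "((\<lambda>_. 0) has_derivative (\<lambda>_. 0)) (at x)" by simp
  then have "(f has_derivative (\<lambda>_. 0)) (at x)"
    by (rule has_derivative_transform_within_open[of _ _ _ _ "-K"]) (use assms in auto)
  then show ?thesis using has_derivative_unique assms(4) by blast
qed

lemma integral_translate_lborel:
  fixes f :: "'a::euclidean_space \<Rightarrow> 'b::{banach, second_countable_topology}"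
  assumes "f \<in> borel_measurable borel"
  shows "(\<integral>x. f (x + c) \<partial>lborel) = (\<integral>x. f x \<partial>lborel)"
proof -
  have "(\<integral>x. f x \<partial>lborel) = (\<integral>x. f x \<partial>(distr lborel borel ((+) c)))"
    by (simp add: lborel_distr_plus)
  also have "\<dots> = (\<integral>x. f (c + x) \<partial>lborel)"
    by (rule integral_distr) (use assms in auto)
  finally show ?thesis by (simp add: add.commute)
qed

lemma integrable_continuous_vanishing:
  fixes f :: "'a::euclidean_space \<Rightarrow> 'b::{banach, second_countable_topology}"
  assumes "continuous_on UNIV f" "compact K" "\<And>x. x \<notin> K \<Longrightarrow> f x = 0"
  shows "integrable lborel f"
proof -
  have "integrable lborel (\<lambda>x. indicator K x *\<^sub>R f x)"
    by (rule borel_integrable_compact) (use assms in \<open>auto intro: continuous_on_subset\<close>)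
  moreover have "(\<lambda>x. indicator K x *\<^sub>R f x) = f"
    using assms(3) by (auto simp: indicator_def)
  ultimately show ?thesis by simp
qed

text \<open>Translation invariance makes every difference quotient integrate to zero.\<close>

lemma integral_directional_derivative_zero:
  fixes f :: "'a::euclidean_space \<Rightarrow> 'b::euclidean_space"
  assumes f': "\<And>x. (f has_derivative f' x) (at x)"
    and cont: "continuous_on UNIV (\<lambda>x. f' x e)"
    and K: "compact K" "\<And>x. x \<notin> K \<Longrightarrow> f x = 0"
  shows "(\<integral>x. f' x e \<partial>lborel) = 0"
proof -
  have contf: "continuous_on UNIV f"
    by (rule has_derivative_continuous_on[of _ _ f']) (simp add: f')
  have g0: "f' x e = 0" if "x \<notin> K" for x
    using has_derivative_zero_outside[OF compact_imp_closed K(2) that f'] K(1) by simp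
  have "compact ((\<lambda>x. f' x e) ` K)"
    by (intro compact_continuous_image K continuous_on_subset[OF cont]) auto
  then obtain B where "\<And>y. y \<in> (\<lambda>x. f' x e) ` K \<Longrightarrow> norm y \<le> B"
    using compact_imp_bounded bounded_iff by metis
  \<comment> \<open>On \<open>K\<close> the bound is \<open>B\<close>; off \<open>K\<close> the
    derivative vanishes, and the maximum with 0 covers these points too.\<close>
  then have B: "norm (f' x e) \<le> max B 0" for x
    using g0[of x] by (cases "x \<in> K") fastforce+
  obtain R where R: "\<And>x. x \<in> K \<Longrightarrow> norm x \<le> R"
    using K(1) compact_imp_bounded bounded_iff by metis
  define h where "h n = inverse (real (Suc n))" for n
  have h: "0 < h n" "h n \<le> 1" for n
    by (auto simp: h_def inverse_le_1_iff)
  have h0: "h \<longlonglongrightarrow> 0" unfolding h_def by (rule LIMSEQ_inverse_real_of_nat)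
  define s where "s n x = (f (x + h n *\<^sub>R e) - f x) /\<^sub>R h n" for n x
  \<comment> \<open>Dominating function for all quotients \<open>s n\<close>: since
    \<open>h n \<le> 1\<close>, both \<open>x\<close> and its translate miss \<open>K\<close> as
    soon as \<open>norm x\<close> exceeds \<open>R + norm e\<close>.\<close>
  define w where "w x = max B 0 * indicat_real (cball 0 (R + norm e)) x" for x :: 'a
  have line: "((\<lambda>t. f (x + t *\<^sub>R e)) has_derivative (\<lambda>s. s *\<^sub>R f' (x + t *\<^sub>R e) e)) (at t within S)"
    for x t S
  proof -
    have "((\<lambda>t. f (x + t *\<^sub>R e)) has_derivative (\<lambda>s. f' (x + t *\<^sub>R e) (s *\<^sub>R e))) (at t within S)"
      by (rule has_derivative_compose[OF _ f', of "\<lambda>t. x + t *\<^sub>R e"])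
         (auto intro!: derivative_eq_intros)
    then show ?thesis
      using linear_scale[OF has_derivative_linear[OF f']] by simp
  qed
  have bound: "norm (s n x) \<le> w x" for n x
  proof (cases "norm x \<le> R + norm e")
    case True
    \<comment> \<open>Mean value inequality for the restriction of \<open>f\<close> to the segment
      from \<open>x\<close> to \<open>x + h n *\<^sub>R e\<close>.\<close>
    have "norm (f (x + h n *\<^sub>R e) - f (x + 0 *\<^sub>R e)) \<le> max B 0 * norm (h n - 0)"
    proof (rule differentiable_bound[where S = "{0..h n}"])
      show "onorm (\<lambda>s. s *\<^sub>R f' (x + t *\<^sub>R e) e) \<le> max B 0" for t
      proof (rule onorm_le)
        fix r :: real
        show "norm (r *\<^sub>R f' (x + t *\<^sub>R e) e) \<le> max B 0 * norm r"
          using mult_left_mono[OF B[of "x + t *\<^sub>R e"], of "norm r"] by (simp add: mult.commute)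
      qed
    qed (use line h[of n] in \<open>auto simp: less_imp_le\<close>)
    then have "norm (s n x) \<le> max B 0"
      using h[of n] by (simp add: s_def divide_simps mult.commute flip: divide_inverse_commute)
    then show ?thesis using True by (simp add: w_def)
  next
    case False
    have "x \<notin> K" using R[of x] False norm_ge_zero[of e] by linarith
    moreover have "x + h n *\<^sub>R e \<notin> K"
    proof
      assume "x + h n *\<^sub>R e \<in> K"
      then have "norm (x + h n *\<^sub>R e) \<le> R" by (rule R)
      moreover have "norm (h n *\<^sub>R e) \<le> norm e"
        using h[of n] mult_right_mono[of "h n" 1 "norm e"] by simp
      ultimately show False
        using False norm_triangle_ineq4[of "x + h n *\<^sub>R e" "h n *\<^sub>R e"] by simp
    qed
    ultimately show ?thesis by (simp add: s_def w_def K)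
  qed
  have lim: "(\<lambda>n. s n x) \<longlonglongrightarrow> f' x e" for x
  proof -
    have "((\<lambda>t. f (x + t *\<^sub>R e)) has_vector_derivative f' x e) (at 0)"
      using line[of x 0 UNIV] by (simp add: has_vector_derivative_def)
    then have "((\<lambda>t. (1 / \<bar>t\<bar>) *\<^sub>R (f (x + t *\<^sub>R e) - (f x + t *\<^sub>R f' x e))) \<longlongrightarrow> 0) (at 0)"
      by (simp add: has_vector_derivative_def has_derivative_within)
    then have "((\<lambda>t. norm ((1 / \<bar>t\<bar>) *\<^sub>R (f (x + t *\<^sub>R e) - (f x + t *\<^sub>R f' x e)))) \<longlongrightarrow> 0) (at 0)"
      by (rule tendsto_norm_zero)
    \<comment> \<open>The derivative is defined with division by the modulus of \<open>t\<close>,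
      the quotient divides by \<open>t\<close> itself; under the norm the sign is
      immaterial.\<close>
    moreover have eq: "norm ((1 / \<bar>t\<bar>) *\<^sub>R (f (x + t *\<^sub>R e) - (f x + t *\<^sub>R f' x e)))
        = norm ((f (x + t *\<^sub>R e) - f x) /\<^sub>R t - f' x e)" if "t \<noteq> 0" for t
    proof -
      have "(f (x + t *\<^sub>R e) - f x) /\<^sub>R t - f' x e
          = (1 / t) *\<^sub>R (f (x + t *\<^sub>R e) - (f x + t *\<^sub>R f' x e))"
        using that by (simp add: algebra_simps divide_inverse)
      then show ?thesis by simp
    qed
    ultimately have "((\<lambda>t. norm ((f (x + t *\<^sub>R e) - f x) /\<^sub>R t - f' x e)) \<longlongrightarrow> 0) (at 0)"
      by (elim Lim_transform_eventually) (simp add: eventually_at_filter)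
    then have "((\<lambda>t. (f (x + t *\<^sub>R e) - f x) /\<^sub>R t) \<longlongrightarrow> f' x e) (at 0)"
      by (rule Lim_null[THEN iffD2, OF tendsto_norm_zero_cancel])
    moreover have "filterlim h (at 0) sequentially"
      using h0 h(1) by (auto simp: filterlim_at less_imp_neq intro!: always_eventually) (metis less_irrefl)
    ultimately show ?thesis
      unfolding s_def by (rule filterlim_compose)
  qed
  have intf: "integrable lborel f"
    by (rule integrable_continuous_vanishing[OF contf K])
  have fm: "f \<in> borel_measurable borel" by (rule borel_measurable_continuous_onI[OF contf])
  have "(\<lambda>n. \<integral>x. s n x \<partial>lborel) \<longlonglongrightarrow> (\<integral>x. f' x e \<partial>lborel)"
  proof (rule integral_dominated_convergence[where w = w])
    show "integrable lborel w"
      unfolding w_def by (intro integrable_mult_right integrable_real_indicator)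
        (use emeasure_bounded_finite[OF bounded_cball, of "0::'a" "R + norm e"] in \<open>auto simp: less_top\<close>)
    show "(\<lambda>x. f' x e) \<in> borel_measurable lborel"
      using borel_measurable_continuous_onI[OF cont] by simp
    show "s n \<in> borel_measurable lborel" for n
      unfolding s_def using fm by measurable
  qed (use bound lim in auto)
  moreover have "(\<integral>x. s n x \<partial>lborel) = 0" for n
  proof -
    have "integrable lborel (\<lambda>x. f (x + h n *\<^sub>R e))"
    proof (rule integrable_continuous_vanishing)
      show "continuous_on UNIV (\<lambda>x. f (x + h n *\<^sub>R e))"
        by (intro continuous_on_compose2[OF contf] continuous_intros) auto
      show "compact ((\<lambda>x. x - h n *\<^sub>R e) ` K)"
        by (intro compact_continuous_image K continuous_intros)
      show "f (x + h n *\<^sub>R e) = 0" if "x \<notin> (\<lambda>x. x - h n *\<^sub>R e) ` K" for x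
      proof (rule K(2))
        show "x + h n *\<^sub>R e \<notin> K"
          using that by (metis add_diff_cancel_right' image_eqI)
      qed
    qed
    then show ?thesis
      unfolding s_def using intf integral_translate_lborel[OF fm] by simp
  qed
  ultimately show ?thesis by (simp add: LIMSEQ_const_iff)
qed

lemma test_fieldsD:
  assumes "\<phi> \<in> test_fields \<Omega>"
  shows "(\<phi> has_derivative frechet_derivative \<phi> (at x)) (at x)"
    and "continuous_on UNIV \<phi>"
    and "continuous_on UNIV (\<lambda>x. frechet_derivative \<phi> (at x) v)"
    and "\<exists>K. compact K \<and> K \<subseteq> \<Omega> \<and> (\<forall>x. x \<notin> K \<longrightarrow> \<phi> x = 0)"
proof -
  have C: "C_diff k \<phi>" for k using assms by (simp add: test_fields_def)
  show "(\<phi> has_derivative frechet_derivative \<phi> (at x)) (at x)"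
    using C[of 1] by (simp add: frechet_derivative_works)
  show "continuous_on UNIV \<phi>" "continuous_on UNIV (\<lambda>x. frechet_derivative \<phi> (at x) v)"
    using C[of 0] C[of 1] by auto
  show "\<exists>K. compact K \<and> K \<subseteq> \<Omega> \<and> (\<forall>x. x \<notin> K \<longrightarrow> \<phi> x = 0)"
    using assms closure_subset[of "{x. \<phi> x \<noteq> 0}"]
    by (intro exI[of _ "closure {x. \<phi> x \<noteq> 0}"]) (auto simp: test_fields_def)
qed

lemma continuous_pderiv_comp:
  assumes "\<phi> \<in> test_fields \<Omega>"
  shows "continuous_on UNIV (pderiv_comp i j \<phi>)"
  unfolding pderiv_comp_def[abs_def]
  by (intro continuous_intros test_fieldsD(3)[OF assms])

lemma pderiv_comp_outside:
  assumes "\<phi> \<in> test_fields \<Omega>" "compact K" "\<And>x. x \<notin> K \<Longrightarrow> \<phi> x = 0" "x \<notin> K"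
  shows "pderiv_comp i j \<phi> x = 0"
  using has_derivative_zero_outside[OF compact_imp_closed[OF assms(2)] assms(3,4) test_fieldsD(1)[OF assms(1)]]
  by (simp add: pderiv_comp_def)

lemma continuous_classical_curl:
  assumes "\<phi> \<in> test_fields \<Omega>"
  shows "continuous_on UNIV (classical_curl \<phi>)"
proof -
  have "continuous_on UNIV (\<lambda>x. classical_curl \<phi> x $ i)" for i
    using exhaust_3[of i]
    by (elim disjE)
       (simp_all add: classical_curl_def continuous_pderiv_comp[OF assms] continuous_on_diff)
  then have "continuous_on UNIV (\<lambda>x. \<chi> i. classical_curl \<phi> x $ i)"
    by (intro continuous_on_vec_lambda)
  then show ?thesis by simp
qed

lemma classical_curl_outside:
  assumes "\<phi> \<in> test_fields \<Omega>" "compact K" "\<And>x. x \<notin> K \<Longrightarrow> \<phi> x = 0" "x \<notin> K"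
  shows "classical_curl \<phi> x = 0"
  by (simp add: classical_curl_def pderiv_comp_outside[OF assms] vec_eq_iff forall_3)

text \<open>A function supported in \<Omega> equals its own extension by zero, so integrals over
  \<Omega> become integrals over the whole space, where translation invariance applies.\<close>

lemma integrable_lebesgue_on_vanishing:
  fixes f :: "'a::euclidean_space \<Rightarrow> 'b::euclidean_space"
  assumes "continuous_on UNIV f" "compact K" "K \<subseteq> \<Omega>" "\<And>x. x \<notin> K \<Longrightarrow> f x = 0"
    "\<Omega> \<in> sets lebesgue"
  shows "integrable (lebesgue_on \<Omega>) f"
    and "integral\<^sup>L (lebesgue_on \<Omega>) f = integral\<^sup>L lborel f"
proof -
  have int: "integrable lborel f" by (rule integrable_continuous_vanishing[OF assms(1,2,4)])
  have eq: "(\<lambda>x. if x \<in> \<Omega> then f x else 0) = f" using assms(3,4) by force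
  show "integrable (lebesgue_on \<Omega>) f"
    using Lebesgue_Measure.integrable_restrict_UNIV[OF assms(5), of f] int unfolding eq
    by (simp add: integrable_completion)
  show "integral\<^sup>L (lebesgue_on \<Omega>) f = integral\<^sup>L lborel f"
    using Lebesgue_Measure.integral_restrict_UNIV[OF assms(5), of f] int unfolding eq
    by (simp add: integral_completion)
qed

lemma L2_fields_continuous_vanishing:
  assumes "continuous_on UNIV \<phi>" "compact K" "K \<subseteq> \<Omega>" "\<And>x. x \<notin> K \<Longrightarrow> \<phi> x = 0"
    "\<Omega> \<in> sets lebesgue"
  shows "\<phi> \<in> L2_fields \<Omega>"
proof -
  have "integrable (lebesgue_on \<Omega>) (\<lambda>x. (norm (\<phi> x))\<^sup>2)"
    by (rule integrable_lebesgue_on_vanishing[where K = K])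
      (use assms in \<open>auto intro!: continuous_intros\<close>)
  then show ?thesis
    using integrable_lebesgue_on_vanishing(1)[OF assms] by (simp add: L2_fields_def)
qed

lemma test_fields_L2:
  assumes "\<phi> \<in> test_fields \<Omega>" "\<Omega> \<in> sets lebesgue"
  shows "\<phi> \<in> L2_fields \<Omega>" "classical_curl \<phi> \<in> L2_fields \<Omega>"
proof -
  obtain K where K: "compact K" "K \<subseteq> \<Omega>" "\<And>x. x \<notin> K \<Longrightarrow> \<phi> x = 0"
    using test_fieldsD(4)[OF assms(1)] by auto
  show "\<phi> \<in> L2_fields \<Omega>"
    using L2_fields_continuous_vanishing[OF test_fieldsD(2)[OF assms(1)] K assms(2)] .
  show "classical_curl \<phi> \<in> L2_fields \<Omega>"
    using L2_fields_continuous_vanishing[OF continuous_classical_curl[OF assms(1)] K(1,2)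
        classical_curl_outside[OF assms(1) K(1,3)] assms(2)] by blast
qed

text \<open>By the product rule the integrand is the derivative of
  \<open>\<phi> x $ j * cnj (\<psi> x $ k)\<close> along axis \<open>i\<close>, and this product has
  compact support, so no boundary term arises.\<close>

lemma pderiv_comp_by_parts:
  assumes \<phi>: "\<phi> \<in> test_fields \<Omega>" and \<psi>: "\<psi> \<in> test_fields \<Omega>" and "\<Omega> \<in> sets lebesgue"
  shows "integrable (lebesgue_on \<Omega>)
      (\<lambda>x. pderiv_comp i j \<phi> x * cnj (\<psi> x $ k) + \<phi> x $ j * cnj (pderiv_comp i k \<psi> x))" (is ?int)
    and "(LINT x|lebesgue_on \<Omega>.
      pderiv_comp i j \<phi> x * cnj (\<psi> x $ k) + \<phi> x $ j * cnj (pderiv_comp i k \<psi> x)) = 0" (is ?zero)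
proof -
  let ?d = "\<lambda>x. pderiv_comp i j \<phi> x * cnj (\<psi> x $ k) + \<phi> x $ j * cnj (pderiv_comp i k \<psi> x)"
  obtain K where K: "compact K" "K \<subseteq> \<Omega>" "\<And>x. x \<notin> K \<Longrightarrow> \<phi> x = 0"
    using test_fieldsD(4)[OF \<phi>] by auto
  note cont = test_fieldsD(2)[OF \<phi>] test_fieldsD(2)[OF \<psi>]
    continuous_pderiv_comp[OF \<phi>] continuous_pderiv_comp[OF \<psi>]
  have cd: "continuous_on UNIV ?d" by (intro continuous_intros cont)
  have d0: "?d x = 0" if "x \<notin> K" for x
    using K(3) pderiv_comp_outside[OF \<phi> K(1,3)] that by simp
  show ?int by (rule integrable_lebesgue_on_vanishing[OF cd K(1,2) d0 assms(3)])
  \<comment> \<open>The full derivative of the product; its value at \<open>axis i 1\<close> is the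
    integrand \<open>?d\<close>.\<close>
  define D where "D x = (\<lambda>e. frechet_derivative \<phi> (at x) e $ j * cnj (\<psi> x $ k)
      + \<phi> x $ j * cnj (frechet_derivative \<psi> (at x) e $ k))" for x
  have der: "((\<lambda>x. \<phi> x $ j * cnj (\<psi> x $ k)) has_derivative D x) (at x)" for x
  proof -
    have "((\<lambda>x. \<phi> x $ j) has_derivative (\<lambda>e. frechet_derivative \<phi> (at x) e $ j)) (at x)"
      by (rule bounded_linear.has_derivative[OF bounded_linear_vec_nth test_fieldsD(1)[OF \<phi>]])
    moreover have "((\<lambda>x. cnj (\<psi> x $ k)) has_derivative (\<lambda>e. cnj (frechet_derivative \<psi> (at x) e $ k))) (at x)"
      by (intro bounded_linear.has_derivative[OF bounded_linear_cnj]
           bounded_linear.has_derivative[OF bounded_linear_vec_nth] test_fieldsD(1)[OF \<psi>])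
    ultimately have "((\<lambda>x. \<phi> x $ j * cnj (\<psi> x $ k)) has_derivative
        (\<lambda>e. \<phi> x $ j * cnj (frechet_derivative \<psi> (at x) e $ k)
          + frechet_derivative \<phi> (at x) e $ j * cnj (\<psi> x $ k))) (at x)"
      by (rule has_derivative_mult)
    then show ?thesis by (simp add: D_def add.commute)
  qed
  have De: "D x (axis i 1) = ?d x" for x by (simp add: D_def pderiv_comp_def)
  have "(\<integral>x. D x (axis i 1) \<partial>lborel) = 0"
    by (rule integral_directional_derivative_zero[OF der _ K(1)]) (use cd K(3) De in auto)
  then show ?zero
    using integrable_lebesgue_on_vanishing(2)[OF cd K(1,2) d0 assms(3)] De by simp
qed

lemma L2_inner_classical_curl:
  assumes \<phi>: "\<phi> \<in> test_fields \<Omega>" and \<psi>: "\<psi> \<in> test_fields \<Omega>" and \<Omega>: "\<Omega> \<in> sets lebesgue"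
  shows "L2_inner \<Omega> (classical_curl \<phi>) \<psi> = L2_inner \<Omega> \<phi> (classical_curl \<psi>)"
proof -
  let ?d = "\<lambda>i j k x. pderiv_comp i j \<phi> x * cnj (\<psi> x $ k) + \<phi> x $ j * cnj (pderiv_comp i k \<psi> x)"
  note parts = pderiv_comp_by_parts[OF \<phi> \<psi> \<Omega>]
  have "L2_inner \<Omega> (classical_curl \<phi>) \<psi> - L2_inner \<Omega> \<phi> (classical_curl \<psi>)
    = (LINT x|lebesgue_on \<Omega>. (\<Sum>j\<in>UNIV. classical_curl \<phi> x $ j * cnj (\<psi> x $ j))
         - (\<Sum>j\<in>UNIV. \<phi> x $ j * cnj (classical_curl \<psi> x $ j)))"
    unfolding L2_inner_def
    by (intro Bochner_Integration.integral_diff[symmetric] L2_inner_integrable test_fields_L2[OF _ \<Omega>] \<phi> \<psi>)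
  \<comment> \<open>One product rule term for each permutation of (1, 2, 3), taken with its sign;
    each integrates to zero.\<close>
  also have "\<dots> = (LINT x|lebesgue_on \<Omega>. (?d 2 3 1 x - ?d 3 2 1 x) + (?d 3 1 2 x - ?d 1 3 2 x)
      + (?d 1 2 3 x - ?d 2 1 3 x))"
    by (rule Bochner_Integration.integral_cong) (auto simp: classical_curl_def sum_3 algebra_simps)
  also have "\<dots> = 0"
    by (simp only: Bochner_Integration.integral_add Bochner_Integration.integral_diff
        Bochner_Integration.integrable_add Bochner_Integration.integrable_diff parts) simp
  finally show ?thesis by simp
qed

lemma is_weak_curl_classical_curl:
  assumes "\<phi> \<in> test_fields \<Omega>" "\<Omega> \<in> sets lebesgue"
  shows "is_weak_curl \<Omega> \<phi> (classical_curl \<phi>)"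
  using L2_inner_classical_curl[OF assms(1) _ assms(2)] by (simp add: is_weak_curl_def)

lemma curl_works:
  assumes "u \<in> H_curl \<Omega>"
  shows "curl \<Omega> u \<in> L2_fields \<Omega>" "is_weak_curl \<Omega> u (curl \<Omega> u)"
proof -
  have "\<exists>w. w \<in> L2_fields \<Omega> \<and> is_weak_curl \<Omega> u w" using assms by (auto simp: H_curl_def)
  then have "curl \<Omega> u \<in> L2_fields \<Omega> \<and> is_weak_curl \<Omega> u (curl \<Omega> u)"
    unfolding curl_def by (rule someI_ex)
  then show "curl \<Omega> u \<in> L2_fields \<Omega>" "is_weak_curl \<Omega> u (curl \<Omega> u)" by auto
qed

subsection \<open>Uniqueness of the weak curl\<close>

text \<open>The classical smooth function that is flat at 0, with a polynomial factor in
  \<open>1 / x\<close> so that the family is closed under differentiation.\<close>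

definition flat_exp :: "real poly \<Rightarrow> real \<Rightarrow> real" where
  "flat_exp p x = (if x > 0 then poly p (1 / x) * exp (- (1 / x)) else 0)"

lemma tendsto_poly_mult_exp_neg: "((\<lambda>y. poly p y * exp (- y)) \<longlongrightarrow> 0) (at_top :: real filter)"
proof -
  have "((\<lambda>y. \<Sum>i\<le>degree p. coeff p i * (y ^ i / exp y)) \<longlongrightarrow> (\<Sum>i\<le>degree p. coeff p i * 0)) at_top"
    by (intro tendsto_sum tendsto_mult tendsto_const tendsto_power_div_exp_0)
  moreover have "(\<lambda>y. \<Sum>i\<le>degree p. coeff p i * (y ^ i / exp y)) = (\<lambda>y. poly p y * exp (- y))"
    by (auto simp: poly_altdef exp_minus divide_inverse sum_distrib_right mult.assoc)
  ultimately show ?thesis by simp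
qed

text \<open>With \<open>y = 1 / x\<close> the chain rule contributes the factor \<open>- y\<^sup>2\<close>, so the derivative is of the same form.\<close>

lemma flat_exp_has_derivative:
  "(flat_exp p has_real_derivative flat_exp (monom 1 2 * (p - pderiv p)) x) (at x)"
proof -
  consider "x < 0" | "x > 0" | "x = 0" by linarith
  then show ?thesis
  proof cases
    case 1
    have "((\<lambda>_. 0) has_real_derivative 0) (at x)" by simp
    then show ?thesis
      using 1 by (auto simp: flat_exp_def
          intro: has_field_derivative_transform_within_open[of "\<lambda>_. 0" _ _ "{..<0}"])
  next
    case 2
    have "((\<lambda>x. poly p (1 / x) * exp (- (1 / x))) has_real_derivative
        flat_exp (monom 1 2 * (p - pderiv p)) x) (at x)"
      using 2 by (auto intro!: derivative_eq_intros simp: flat_exp_def poly_monom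
          power2_eq_square field_simps)
    then show ?thesis
      by (rule has_field_derivative_transform_within_open[of _ _ _ "{0<..}"])
         (use 2 in \<open>auto simp: flat_exp_def\<close>)
  next
    case 3
    have "((\<lambda>h. flat_exp p h / h) \<longlongrightarrow> 0) (at_right 0)"
    proof -
      \<comment> \<open>Dividing by \<open>h\<close> multiplies the polynomial by its variable, that
        is, replaces \<open>p\<close> by \<open>pCons 0 p\<close>; exponential decay then gives the
        right-hand limit.\<close>
      have "((\<lambda>h. poly (pCons 0 p) (inverse h) * exp (- inverse h)) \<longlongrightarrow> 0) (at_right (0::real))"
        by (rule filterlim_compose[OF tendsto_poly_mult_exp_neg filterlim_inverse_at_top_right])
      then show ?thesis
        by (rule Lim_transform_eventually)
           (auto simp: flat_exp_def divide_inverse eventually_at_filter)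
    qed
    moreover have "((\<lambda>h. flat_exp p h / h) \<longlongrightarrow> 0) (at_left 0)"
      by (rule Lim_transform_eventually[OF tendsto_const])
         (auto simp: flat_exp_def eventually_at_filter)
    ultimately have "((\<lambda>h. flat_exp p h / h) \<longlongrightarrow> 0) (at 0)"
      by (simp add: filterlim_split_at)
    then show ?thesis using 3 by (simp add: DERIV_def flat_exp_def)
  qed
qed

text \<open>An algebra of functions closed under directional derivatives. Smoothness of every order
  follows by induction, without formulas for higher derivatives.\<close>

inductive flat_smooth :: "(real^'n \<Rightarrow> real) \<Rightarrow> bool" where
  flat: "flat_smooth (\<lambda>x. flat_exp p (a * x $ i + b))"
| const: "flat_smooth (\<lambda>x. c)"
| add: "flat_smooth f \<Longrightarrow> flat_smooth g \<Longrightarrow> flat_smooth (\<lambda>x. f x + g x)"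
| mult: "flat_smooth f \<Longrightarrow> flat_smooth g \<Longrightarrow> flat_smooth (\<lambda>x. f x * g x)"

lemma flat_smooth_prod:
  assumes "finite I" "\<And>i. i \<in> I \<Longrightarrow> flat_smooth (f i)"
  shows "flat_smooth (\<lambda>x. \<Prod>i\<in>I. f i x)"
  using assms by (induction I rule: finite_induct) (auto intro: flat_smooth.intros)

text \<open>The chain, sum and product rules stay within the generating rules: for a fixed direction
  \<open>v\<close>, its coordinates enter only as constants.\<close>

lemma flat_smooth_derivative:
  assumes "flat_smooth f"
  shows "\<exists>f'. (\<forall>x. (f has_derivative f' x) (at x)) \<and> (\<forall>v. flat_smooth (\<lambda>x. f' x v))"
  using assms
proof induction
  case (flat p a i b)
  let ?q = "monom 1 2 * (p - pderiv p)"
  have "((\<lambda>x. flat_exp p (a * x $ i + b)) has_derivative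
      (\<lambda>v. flat_exp ?q (a * x $ i + b) * (a * v $ i))) (at x)" for x
  proof -
    have "((\<lambda>x. a * x $ i + b) has_derivative (\<lambda>v. a * v $ i)) (at x)"
      by (auto intro!: derivative_eq_intros bounded_linear.has_derivative[OF bounded_linear_vec_nth])
    then show ?thesis
      using has_derivative_compose[OF _ flat_exp_has_derivative[unfolded has_field_derivative_def]]
      by blast
  qed
  moreover have "flat_smooth (\<lambda>x. flat_exp ?q (a * x $ i + b) * (a * v $ i))" for v
    by (intro flat_smooth.intros)
  ultimately show ?case
    by (intro exI[of _ "\<lambda>x v. flat_exp ?q (a * x $ i + b) * (a * v $ i)"]) auto
next
  case (const c)
  show ?case by (rule exI[of _ "\<lambda>x v. 0"]) (auto intro: flat_smooth.const)
next
  case (add f g)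
  then obtain f' g' where
    "\<And>x. (f has_derivative f' x) (at x)" "\<And>v. flat_smooth (\<lambda>x. f' x v)"
    "\<And>x. (g has_derivative g' x) (at x)" "\<And>v. flat_smooth (\<lambda>x. g' x v)" by blast
  then show ?case
    by (intro exI[of _ "\<lambda>x v. f' x v + g' x v"]) (auto intro: flat_smooth.add has_derivative_add)
next
  case (mult f g)
  then obtain f' g' where
    "\<And>x. (f has_derivative f' x) (at x)" "\<And>v. flat_smooth (\<lambda>x. f' x v)"
    "\<And>x. (g has_derivative g' x) (at x)" "\<And>v. flat_smooth (\<lambda>x. g' x v)" by blast
  then show ?case
    by (intro exI[of _ "\<lambda>x v. f x * g' x v + f' x v * g x"])
       (auto intro!: flat_smooth.add flat_smooth.mult has_derivative_mult mult.hyps)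
qed

lemma flat_smooth_continuous:
  assumes "flat_smooth f"
  shows "continuous_on UNIV f"
proof -
  from flat_smooth_derivative[OF assms] obtain f' where "\<forall>x. (f has_derivative f' x) (at x)"
    by (elim exE conjE)
  then show ?thesis by (intro has_derivative_continuous_on[of _ _ f']) simp
qed

text \<open>Differentiating along \<open>v\<close> replaces \<open>f\<close> by another member of
  the class with the same vector \<open>w\<close>, so the induction must leave \<open>f\<close>
  arbitrary.\<close>

lemma flat_smooth_C_diff:
  fixes w :: "complex^3"
  assumes "flat_smooth f"
  shows "C_diff k (\<lambda>x. f x *\<^sub>R w)"
  using assms
proof (induction k arbitrary: f)
  case 0
  then show ?case by (simp add: flat_smooth_continuous continuous_on_scaleR)
next
  case (Suc k)
  from flat_smooth_derivative[OF Suc.prems] obtain f'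
    where f'_all: "\<forall>x. (f has_derivative f' x) (at x)" "\<forall>v. flat_smooth (\<lambda>x. f' x v)"
    by (elim exE conjE)
  note f' = f'_all[THEN spec]
  have d: "((\<lambda>x. f x *\<^sub>R w) has_derivative (\<lambda>v. f' x v *\<^sub>R w)) (at x)" for x
    by (rule has_derivative_scaleR_left[OF f'(1)])
  then have "frechet_derivative (\<lambda>x. f x *\<^sub>R w) (at x) = (\<lambda>v. f' x v *\<^sub>R w)" for x
    by (rule frechet_derivative_at[symmetric])
  moreover have "(\<lambda>x. f x *\<^sub>R w) differentiable (at x)" for x
    unfolding differentiable_def by (rule exI[of _ "\<lambda>v. f' x v *\<^sub>R w"]) (rule d)
  ultimately show ?case using Suc.IH[OF f'(2)] by simp
qed

text \<open>Each coordinate gets a cutoff at both faces of the box, and dilation by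
  \<open>Suc n\<close> drives the cutoffs to 1 inside. The arguments are written as
  \<open>a * x $ i + b\<close> to fit the generators of \<open>flat_smooth\<close>.\<close>

definition box_bump :: "real^'n \<Rightarrow> real^'n \<Rightarrow> nat \<Rightarrow> real^'n \<Rightarrow> real" where
  "box_bump a b n x = (\<Prod>i\<in>UNIV. flat_exp 1 (real (Suc n) * x $ i + - (real (Suc n) * a $ i))
     * flat_exp 1 (- real (Suc n) * x $ i + real (Suc n) * b $ i))"

lemma flat_smooth_box_bump: "flat_smooth (box_bump a b n)"
  unfolding box_bump_def[abs_def] by (intro flat_smooth_prod flat_smooth.intros) auto

lemma flat_exp_1_bounds: "0 \<le> flat_exp 1 x" "flat_exp 1 x \<le> 1"
  by (auto simp: flat_exp_def)

lemma box_bump_bounds: "0 \<le> box_bump a b n x" "box_bump a b n x \<le> 1"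
  unfolding box_bump_def
  by (auto intro!: prod_nonneg prod_le_1 mult_le_one flat_exp_1_bounds mult_nonneg_nonneg)

lemma box_bump_outside:
  assumes "x \<notin> box a b"
  shows "box_bump a b n x = 0"
proof -
  obtain i where "x $ i \<le> a $ i \<or> b $ i \<le> x $ i"
    using assms by (auto simp: mem_box_cart not_less)
  then have "real (Suc n) * x $ i + - (real (Suc n) * a $ i) \<le> 0
      \<or> - real (Suc n) * x $ i + real (Suc n) * b $ i \<le> 0"
    using mult_left_mono[of "x $ i" "a $ i" "real (Suc n)"] mult_left_mono[of "b $ i" "x $ i" "real (Suc n)"]
    by (auto simp del: of_nat_Suc)
  then have "flat_exp 1 (real (Suc n) * x $ i + - (real (Suc n) * a $ i))
     * flat_exp 1 (- real (Suc n) * x $ i + real (Suc n) * b $ i) = 0"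
    by (elim disjE) (simp_all only: flat_exp_def not_less[symmetric] if_False mult_zero_left mult_zero_right)
  then show ?thesis unfolding box_bump_def by (intro prod_zero) auto
qed

lemma flat_exp_1_dilate:
  assumes "0 < y"
  shows "(\<lambda>n. flat_exp 1 (real (Suc n) * y)) \<longlonglongrightarrow> 1"
proof -
  have "(\<lambda>n. exp (- (inverse (real (Suc n)) * (1 / y)))) \<longlonglongrightarrow> exp (- (0 * (1 / y)))"
    by (intro tendsto_intros LIMSEQ_inverse_real_of_nat)
  moreover have "flat_exp 1 (real (Suc n) * y) = exp (- (inverse (real (Suc n)) * (1 / y)))" for n
    using assms by (simp add: flat_exp_def divide_inverse)
  ultimately show ?thesis by simp
qed

lemma box_bump_tendsto: "(\<lambda>n. box_bump a b n x) \<longlonglongrightarrow> indicat_real (box a b) x"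
proof (cases "x \<in> box a b")
  case True
  have "(\<lambda>n. \<Prod>i\<in>UNIV. flat_exp 1 (real (Suc n) * (x $ i - a $ i)) * flat_exp 1 (real (Suc n) * (b $ i - x $ i)))
      \<longlonglongrightarrow> (\<Prod>i\<in>(UNIV :: 'a set). 1 * 1)"
    using True by (intro tendsto_prod tendsto_mult flat_exp_1_dilate) (auto simp: mem_box_cart)
  then show ?thesis using True by (simp add: box_bump_def algebra_simps)
qed (simp add: box_bump_outside)

lemma box_bump_test_field:
  assumes "cbox a b \<subseteq> \<Omega>"
  shows "(\<lambda>x. box_bump a b n x *\<^sub>R w) \<in> test_fields \<Omega>"
proof -
  have "{x. box_bump a b n x *\<^sub>R w \<noteq> 0} \<subseteq> cbox a b"
    using box_bump_outside box_subset_cbox by (metis (mono_tags, lifting) mem_Collect_eq scaleR_zero_left subsetD subsetI)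
  then have sub: "closure {x. box_bump a b n x *\<^sub>R w \<noteq> 0} \<subseteq> cbox a b"
    by (intro closure_minimal) auto
  then have "compact (closure {x. box_bump a b n x *\<^sub>R w \<noteq> 0})"
    using bounded_subset[OF bounded_cbox] compact_eq_bounded_closed by blast
  then show ?thesis
    using sub assms flat_smooth_C_diff[OF flat_smooth_box_bump] by (auto simp: test_fields_def)
qed

section \<open>Fields orthogonal to all test fields\<close>

text \<open>Boxes have finite measure and |z_j| \<le> |z|^2 + 1. Extending by zero makes the
  component a function on the whole space, as Lebesgue differentiation requires.\<close>

lemma L2_fields_locally_integrable:
  assumes z: "z \<in> L2_fields \<Omega>" and \<Omega>: "\<Omega> \<in> sets lebesgue"
  shows "integrable (lebesgue_on (cbox a b)) (\<lambda>x. if x \<in> \<Omega> then z x $ j else 0)"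
proof (rule Bochner_Integration.integrable_bound)
  have "integrable lebesgue (\<lambda>x. if x \<in> \<Omega> then (norm (z x))\<^sup>2 else 0)"
    by (rule Lebesgue_Measure.integrable_restrict_UNIV[OF \<Omega>, THEN iffD2, OF L2_fieldsD(2)[OF z]])
  then have "integrable (lebesgue_on (cbox a b)) (\<lambda>x. if x \<in> \<Omega> then (norm (z x))\<^sup>2 else 0)"
    by (subst integrable_restrict_space) (auto intro: integrable_mult_indicator simp del: real_scaleR_def)
  moreover have "integrable (lebesgue_on (cbox a b)) (\<lambda>x. 1 :: real)"
    by (simp add: finite_measure.integrable_const finite_measure_lebesgue_on)
  ultimately show "integrable (lebesgue_on (cbox a b)) (\<lambda>x. (if x \<in> \<Omega> then (norm (z x))\<^sup>2 else 0) + 1)"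
    by (rule Bochner_Integration.integrable_add)
  have "(\<lambda>x. if x \<in> \<Omega> then z x else 0) \<in> borel_measurable lebesgue"
    by (rule borel_measurable_if[OF \<Omega>, THEN iffD2, OF L2_fieldsD(1)[OF z]])
  then have "(\<lambda>x. if x \<in> \<Omega> then z x else 0) \<in> borel_measurable (lebesgue_on (cbox a b))"
    by (rule measurable_restrict_space1)
  then have "(\<lambda>x. (if x \<in> \<Omega> then z x else 0) $ j) \<in> borel_measurable (lebesgue_on (cbox a b))"
    by (rule borel_measurable_continuous_on[rotated]) (intro continuous_intros)
  moreover have "(\<lambda>x. (if x \<in> \<Omega> then z x else 0) $ j) = (\<lambda>x. if x \<in> \<Omega> then z x $ j else 0)" by auto
  ultimately show "(\<lambda>x. if x \<in> \<Omega> then z x $ j else 0) \<in> borel_measurable (lebesgue_on (cbox a b))"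
    by simp
  have "norm (z x $ j) \<le> (norm (z x))\<^sup>2 + 1" for x
  proof -
    have "norm (z x $ j) \<le> norm (z x)" unfolding norm_vec_def by (rule member_le_L2_set) auto
    also have "\<dots> \<le> (norm (z x))\<^sup>2 + 1"
      using sum_squares_bound[of "norm (z x)" 1] norm_ge_zero[of "z x"]
      unfolding power_one mult_1_right by linarith
    finally show ?thesis .
  qed
  then show "AE x in lebesgue_on (cbox a b). norm (if x \<in> \<Omega> then z x $ j else 0)
      \<le> norm ((if x \<in> \<Omega> then (norm (z x))\<^sup>2 else 0) + 1)"
    by auto
qed

text \<open>Orthogonality to the bumps in direction \<open>j\<close> passes to the limit by
  dominated convergence. The pointwise limit is the indicator of the open box, hence the form of the
  integrand.\<close>

lemma integral_box_eq_0_of_weakly_zero: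
  assumes z: "z \<in> L2_fields \<Omega>" and \<Omega>: "\<Omega> \<in> sets lebesgue"
    and orth: "\<And>\<phi>. \<phi> \<in> test_fields \<Omega> \<Longrightarrow> L2_inner \<Omega> z \<phi> = 0"
    and sub: "cbox a b \<subseteq> \<Omega>"
  shows "(LINT x|lebesgue_on (cbox a b). indicat_real (box a b) x *\<^sub>R (z x $ j)) = 0"
proof -
  have int: "integrable (lebesgue_on (cbox a b)) (\<lambda>x. z x $ j)"
    using L2_fields_locally_integrable[OF z \<Omega>, of a b j] sub
    by (subst Bochner_Integration.integrable_cong[where g = "\<lambda>x. if x \<in> \<Omega> then z x $ j else 0"]) auto
  have meas: "(\<lambda>x. box_bump a b n x) \<in> borel_measurable (lebesgue_on (cbox a b))" for n
  proof -
    have "continuous_on UNIV (box_bump a b n)"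
      by (rule flat_smooth_continuous[OF flat_smooth_box_bump])
    then show ?thesis
      by (intro continuous_imp_measurable_on_sets_lebesgue)
         (auto intro: continuous_on_subset)
  qed
  have "(\<lambda>n. LINT x|lebesgue_on (cbox a b). box_bump a b n x *\<^sub>R (z x $ j))
      \<longlonglongrightarrow> (LINT x|lebesgue_on (cbox a b). indicat_real (box a b) x *\<^sub>R (z x $ j))"
  proof (rule integral_dominated_convergence[where w = "\<lambda>x. norm (z x $ j)"])
    show "AE x in lebesgue_on (cbox a b). (\<lambda>n. box_bump a b n x *\<^sub>R (z x $ j))
        \<longlonglongrightarrow> indicat_real (box a b) x *\<^sub>R (z x $ j)"
      by (intro AE_I2 tendsto_intros box_bump_tendsto)
    show "AE x in lebesgue_on (cbox a b). norm (box_bump a b n x *\<^sub>R (z x $ j)) \<le> norm (z x $ j)" for n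
      using box_bump_bounds[of a b n] by (auto intro!: mult_left_le_one_le)
    show "(\<lambda>x. box_bump a b n x *\<^sub>R (z x $ j)) \<in> borel_measurable (lebesgue_on (cbox a b))" for n
      using meas int by (intro borel_measurable_scaleR) auto
    show "(\<lambda>x. indicat_real (box a b) x *\<^sub>R (z x $ j)) \<in> borel_measurable (lebesgue_on (cbox a b))"
      using int by (intro borel_measurable_scaleR borel_measurable_indicator)
        (auto simp: sets_restrict_space_iff box_subset_cbox)
  qed (use int in auto)
  moreover have "(LINT x|lebesgue_on (cbox a b). box_bump a b n x *\<^sub>R (z x $ j)) = 0" for n
  proof -
    \<comment> \<open>The direction \<open>axis j 1\<close> isolates component \<open>j\<close>, and
      the bump is real, so conjugation leaves it unchanged.\<close>
    have "0 = L2_inner \<Omega> z (\<lambda>x. box_bump a b n x *\<^sub>R axis j 1)"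
      using orth[OF box_bump_test_field[OF sub]] by simp
    also have "\<dots> = (LINT x|lebesgue_on \<Omega>. (if x \<in> cbox a b then box_bump a b n x *\<^sub>R (z x $ j) else 0))"
      unfolding L2_inner_def
    proof (rule Bochner_Integration.integral_cong)
      fix x
      have "cnj ((box_bump a b n x *\<^sub>R axis j (1::complex)) $ k)
          = (if k = j then complex_of_real (box_bump a b n x) else 0)" for k
        by (simp add: axis_def complex_eq_iff)
      then have "(\<Sum>k\<in>UNIV. z x $ k * cnj ((box_bump a b n x *\<^sub>R axis j (1::complex)) $ k))
          = (\<Sum>k\<in>UNIV. if k = j then box_bump a b n x *\<^sub>R (z x $ j) else 0)"
        by (intro sum.cong) (auto simp: scaleR_conv_of_real)
      then show "(\<Sum>k\<in>UNIV. z x $ k * cnj ((box_bump a b n x *\<^sub>R axis j (1::complex)) $ k))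
          = (if x \<in> cbox a b then box_bump a b n x *\<^sub>R (z x $ j) else 0)"
        using box_bump_outside[of x a b] box_subset_cbox[of a b] by auto
    qed simp
    also have "\<dots> = (LINT x|lebesgue_on (cbox a b). box_bump a b n x *\<^sub>R (z x $ j))"
      by (rule Lebesgue_Measure.integral_restrict) (use sub \<Omega> in auto)
    finally show ?thesis by simp
  qed
  ultimately show ?thesis by (simp add: LIMSEQ_const_iff)
qed

text \<open>Box integrals of \<open>z\<close> vanish, so Lebesgue differentiation gives \<open>z = 0\<close> almost everywhere.\<close>

lemma weakly_zero_imp_AE_zero:
  assumes z: "z \<in> L2_fields \<Omega>" and \<Omega>: "open \<Omega>"
    and orth: "\<And>\<phi>. \<phi> \<in> test_fields \<Omega> \<Longrightarrow> L2_inner \<Omega> z \<phi> = 0"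
  shows "AE x in lebesgue_on \<Omega>. z x = 0"
proof -
  have leb: "\<Omega> \<in> sets lebesgue" using \<Omega> by simp
  have "AE x in lebesgue_on \<Omega>. z x $ j = 0" for j
  proof -
    define f where "f x = (if x \<in> \<Omega> then z x $ j else 0)" for x
    have int: "integrable (lebesgue_on (cbox a b)) f" for a b
      using L2_fields_locally_integrable[OF z leb] by (simp add: f_def[abs_def])
    then have "f integrable_on cbox a b" for a b
      by (rule integrable_on_lebesgue_on) simp
    \<comment> \<open>Lebesgue differentiation along shrinking cubes with lower corner
      \<open>x\<close>.\<close>
    then obtain N where N: "negligible N" and diff: "\<And>x e. \<lbrakk>x \<notin> N; 0 < e\<rbrakk> \<Longrightarrow>
        \<exists>d>0. \<forall>h. 0 < h \<and> h < d \<longrightarrow>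
          norm (integral (cbox x (x + h *\<^sub>R One)) f /\<^sub>R h ^ DIM(real^3) - f x) < e"
      by (rule integrable_ccontinuous_explicit) auto
    \<comment> \<open>The bumps give the integral over the open box; passing to the closed box adds
      only the faces, which are null.\<close>
    have box0: "integral (cbox a b) f = 0" if "cbox a b \<subseteq> \<Omega>" for a b
    proof -
      have "set_integrable lebesgue (cbox a b) f"
        using int[of a b] by (simp add: set_integrable_def integrable_restrict_space)
      then have "set_integrable lebesgue (box a b) f"
        by (rule set_integrable_subset) (auto simp: box_subset_cbox)
      then have bint: "integrable (lebesgue_on (box a b)) f"
        by (simp add: set_integrable_def integrable_restrict_space)
      have "0 = (LINT x|lebesgue_on (cbox a b). indicat_real (box a b) x *\<^sub>R (z x $ j))"
        using integral_box_eq_0_of_weakly_zero[OF z leb orth that] by simp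
      also have "\<dots> = (LINT x|lebesgue_on (cbox a b). (if x \<in> box a b then f x else 0))"
        by (rule Bochner_Integration.integral_cong) (use that in \<open>auto simp: f_def\<close>)
      also have "\<dots> = (LINT x|lebesgue_on (box a b). f x)"
        by (rule Lebesgue_Measure.integral_restrict) (auto simp: box_subset_cbox)
      also have "\<dots> = integral (box a b) f"
        by (rule lebesgue_integral_eq_integral[OF bint]) simp
      finally show ?thesis by (simp add: integral_open_interval)
    qed
    have "f x = 0" if x: "x \<in> \<Omega>" "x \<notin> N" for x
    proof (rule ccontr)
      assume "f x \<noteq> 0"
      then obtain d where d: "d > 0" "\<And>h. 0 < h \<Longrightarrow> h < d \<Longrightarrow>
          norm (integral (cbox x (x + h *\<^sub>R One)) f /\<^sub>R h ^ DIM(real^3) - f x) < norm (f x)"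
        using diff[OF x(2), of "norm (f x)"] by auto
      obtain r where r: "r > 0" "ball x r \<subseteq> \<Omega>"
        using \<Omega> x(1) open_contains_ball by blast
      \<comment> \<open>The first bound makes the cube small enough for differentiation; the second
        keeps its diameter \<open>h * norm One\<close> below \<open>r\<close>, so the cube lies in
        \<Omega>.\<close>
      define h where "h = min (d / 2) (r / (2 * norm (One :: real^3)))"
      have One: "norm (One :: real^3) > 0" by simp
      have h: "0 < h" "h < d" "h * norm (One :: real^3) < r"
      proof -
        show "0 < h" "h < d" using d(1) r(1) One by (auto simp: h_def)
        have "h * norm (One :: real^3) \<le> (r / (2 * norm (One :: real^3))) * norm (One :: real^3)"
          using One by (intro mult_right_mono) (auto simp: h_def)
        also have "\<dots> = r / 2" using One by simp
        finally show "h * norm (One :: real^3) < r" using r(1) by simp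
      qed
      have "cbox x (x + h *\<^sub>R One) \<subseteq> \<Omega>"
      proof
        fix y assume y: "y \<in> cbox x (x + h *\<^sub>R One)"
        have "norm (y - x) \<le> norm (h *\<^sub>R One :: real^3)"
          by (rule norm_le_componentwise)
             (use y h(1) in \<open>auto simp: mem_box inner_diff_left inner_add_left\<close>)
        then have "y \<in> ball x r" using h by (simp add: dist_norm norm_minus_commute)
        then show "y \<in> \<Omega>" using r by auto
      qed
      \<comment> \<open>The average over the cube is zero, so the estimate would read
        \<open>norm (f x) < norm (f x)\<close>.\<close>
      then show False using d(2)[OF h(1,2)] box0 by simp
    qed
    moreover have "AE x in lebesgue. x \<notin> N"
      using N by (simp add: AE_not_in negligible_iff_null_sets)
    ultimately have "AE x in lebesgue. x \<in> \<Omega> \<longrightarrow> z x $ j = 0"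
      by (auto simp: f_def elim!: eventually_mono)
    then show ?thesis using leb by (subst AE_restrict_space_iff) auto
  qed
  then have "AE x in lebesgue_on \<Omega>. \<forall>j\<in>UNIV. z x $ j = 0"
    by (subst AE_finite_all) auto
  then show ?thesis by (simp add: vec_eq_iff)
qed

lemma L2_inner_cong_AE:
  assumes "AE x in lebesgue_on \<Omega>. u x = v x"
    and "u \<in> L2_fields \<Omega>" "v \<in> L2_fields \<Omega>" "w \<in> L2_fields \<Omega>"
  shows "L2_inner \<Omega> w u = L2_inner \<Omega> w v"
  unfolding L2_inner_def
proof (rule integral_cong_AE)
  show "(\<lambda>x. \<Sum>j\<in>UNIV. w x $ j * cnj (u x $ j)) \<in> borel_measurable (lebesgue_on \<Omega>)"
    "(\<lambda>x. \<Sum>j\<in>UNIV. w x $ j * cnj (v x $ j)) \<in> borel_measurable (lebesgue_on \<Omega>)"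
    by (intro measurable_sum_mult_cnj L2_fieldsD(1) assms)+
  show "AE x in lebesgue_on \<Omega>. (\<Sum>j\<in>UNIV. w x $ j * cnj (u x $ j)) = (\<Sum>j\<in>UNIV. w x $ j * cnj (v x $ j))"
    using assms(1) by eventually_elim simp
qed

text \<open>The difference of two weak curls is orthogonal to every test field. This makes results
  independent of the choice hidden in \<open>curl\<close>.\<close>

lemma curl_eq_weak_curl:
  assumes \<Omega>: "open \<Omega>" and "is_weak_curl \<Omega> u w" "w \<in> L2_fields \<Omega>" "u \<in> L2_fields \<Omega>"
  shows "AE x in lebesgue_on \<Omega>. curl \<Omega> u x = w x"
proof -
  have u: "u \<in> H_curl \<Omega>" using assms by (auto simp: H_curl_def)
  have "AE x in lebesgue_on \<Omega>. curl \<Omega> u x - w x = 0"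
  proof (rule weakly_zero_imp_AE_zero[OF _ \<Omega>])
    show "(\<lambda>x. curl \<Omega> u x - w x) \<in> L2_fields \<Omega>"
      by (intro L2_fields_diff curl_works(1)[OF u] assms)
    show "L2_inner \<Omega> (\<lambda>x. curl \<Omega> u x - w x) \<phi> = 0" if "\<phi> \<in> test_fields \<Omega>" for \<phi>
      using that curl_works[OF u] assms test_fields_L2(1)[OF that]
      by (subst L2_inner_diff_left) (auto simp: is_weak_curl_def)
  qed
  then show ?thesis by simp
qed

section \<open>Adjointness of the two curls\<close>

text \<open>Linearity is stated for the relation, since the chosen representatives in
  \<open>curl\<close> need not be additive pointwise.\<close>

lemma is_weak_curl_diff:
  assumes "is_weak_curl \<Omega> u w" "is_weak_curl \<Omega> u' w'" "\<Omega> \<in> sets lebesgue"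
    and "u \<in> L2_fields \<Omega>" "u' \<in> L2_fields \<Omega>" "w \<in> L2_fields \<Omega>" "w' \<in> L2_fields \<Omega>"
  shows "is_weak_curl \<Omega> (\<lambda>x. u x - u' x) (\<lambda>x. w x - w' x)"
  unfolding is_weak_curl_def
proof
  fix \<phi> assume \<phi>: "\<phi> \<in> test_fields \<Omega>"
  then have "L2_inner \<Omega> w \<phi> = L2_inner \<Omega> u (classical_curl \<phi>)"
    "L2_inner \<Omega> w' \<phi> = L2_inner \<Omega> u' (classical_curl \<phi>)"
    using assms(1,2) by (auto simp only: is_weak_curl_def)
  then show "L2_inner \<Omega> (\<lambda>x. w x - w' x) \<phi> = L2_inner \<Omega> (\<lambda>x. u x - u' x) (classical_curl \<phi>)"
    by (simp only: L2_inner_diff_left assms test_fields_L2[OF \<phi> assms(3)])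
qed

text \<open>With a test field in place of \<open>u\<close> this is the definition of the weak curl
  of \<open>v\<close>; approximation in the graph norm and Cauchy-Schwarz carry it over to
  \<open>u\<close>.\<close>

lemma L2_inner_curl_symmetric:
  assumes \<Omega>: "open \<Omega>" and u: "u \<in> H0_curl \<Omega>" and v: "v \<in> H_curl \<Omega>"
  shows "L2_inner \<Omega> (curl \<Omega> v) u = L2_inner \<Omega> v (curl \<Omega> u)"
proof -
  have leb: "\<Omega> \<in> sets lebesgue" using \<Omega> by simp
  have uH: "u \<in> H_curl \<Omega>" using u by (simp add: H0_curl_def)
  have L2: "u \<in> L2_fields \<Omega>" "v \<in> L2_fields \<Omega>" "curl \<Omega> u \<in> L2_fields \<Omega>" "curl \<Omega> v \<in> L2_fields \<Omega>"
    using uH v curl_works(1) by (auto simp: H_curl_def)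
  let ?D = "L2_inner \<Omega> (curl \<Omega> v) u - L2_inner \<Omega> v (curl \<Omega> u)"
  let ?C = "L2_norm \<Omega> (curl \<Omega> v) + L2_norm \<Omega> v"
  have le: "norm ?D \<le> \<epsilon> * ?C" if pos: "\<epsilon> > 0" for \<epsilon>
  proof -
    obtain \<phi> where \<phi>: "\<phi> \<in> test_fields \<Omega>" and small: "curl_graph_norm \<Omega> (\<lambda>x. u x - \<phi> x) < \<epsilon>"
      using u pos by (auto simp: H0_curl_def)
    note \<phi>2 = test_fields_L2[OF \<phi> leb]
    \<comment> \<open>\<open>?w\<close> is a weak curl of the error \<open>?e\<close>, but the graph
      norm measures the chosen \<open>curl \<Omega> ?e\<close>; the two agree almost
      everywhere.\<close>
    let ?e = "\<lambda>x. u x - \<phi> x" and ?w = "\<lambda>x. curl \<Omega> u x - classical_curl \<phi> x"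
    have e: "?e \<in> L2_fields \<Omega>" and w: "?w \<in> L2_fields \<Omega>" by (intro L2_fields_diff L2 \<phi>2)+
    have wc: "is_weak_curl \<Omega> ?e ?w"
      by (rule is_weak_curl_diff) (use L2 \<phi>2 leb curl_works(2)[OF uH] is_weak_curl_classical_curl[OF \<phi> leb] in auto)
    then have eH: "?e \<in> H_curl \<Omega>" using e w by (auto simp: H_curl_def)
    \<comment> \<open>The contributions of \<open>\<phi>\<close> to \<open>?D\<close> cancel,
      leaving only those of the error.\<close>
    have "L2_inner \<Omega> (curl \<Omega> v) \<phi> = L2_inner \<Omega> v (classical_curl \<phi>)"
      using curl_works(2)[OF v] \<phi> by (simp add: is_weak_curl_def)
    then have "?D = L2_inner \<Omega> (curl \<Omega> v) ?e - L2_inner \<Omega> v ?w"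
      using L2 \<phi>2 by (simp add: L2_inner_diff_right)
    also have "L2_inner \<Omega> v ?w = L2_inner \<Omega> v (curl \<Omega> ?e)"
      using L2_inner_cong_AE[OF curl_eq_weak_curl[OF \<Omega> wc w e] curl_works(1)[OF eH] w L2(2)] by simp
    finally have "norm ?D \<le> norm (L2_inner \<Omega> (curl \<Omega> v) ?e) + norm (L2_inner \<Omega> v (curl \<Omega> ?e))"
      by (simp add: norm_triangle_ineq4)
    also have "\<dots> \<le> L2_norm \<Omega> (curl \<Omega> v) * L2_norm \<Omega> ?e + L2_norm \<Omega> v * L2_norm \<Omega> (curl \<Omega> ?e)"
      by (intro add_mono L2_Cauchy_Schwarz L2 e curl_works(1)[OF eH])
    also have "\<dots> \<le> L2_norm \<Omega> (curl \<Omega> v) * \<epsilon> + L2_norm \<Omega> v * \<epsilon>"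
    proof -
      have "L2_norm \<Omega> ?e \<le> curl_graph_norm \<Omega> ?e" "L2_norm \<Omega> (curl \<Omega> ?e) \<le> curl_graph_norm \<Omega> ?e"
        unfolding curl_graph_norm_def by (auto intro: real_le_rsqrt)
      then show ?thesis
        using small by (intro add_mono mult_left_mono L2_norm_nonneg) auto
    qed
    finally show ?thesis by (simp add: algebra_simps)
  qed
  have "?D = 0"
  proof (rule ccontr)
    assume "?D \<noteq> 0"
    then have pos: "norm ?D > 0" by simp
    have C: "?C + 1 > 0" "?C \<ge> 0" using L2_norm_nonneg[of \<Omega>] by (simp_all add: add_nonneg_pos)
    \<comment> \<open>The summand 1 keeps the divisor positive when \<open>?C\<close> is 0.\<close>
    have "norm ?D \<le> norm ?D / (?C + 1) * ?C" using le[of "norm ?D / (?C + 1)"] pos C by simp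
    then have "norm ?D * (?C + 1) \<le> norm ?D * ?C" using C(1) by (simp add: pos_le_divide_eq)
    then show False using pos by (simp add: algebra_simps)
  qed
  then show ?thesis by simp
qed

subsection \<open>The quadratic form of the pencil\<close>

text \<open>Finiteness of the essential supremum matters here, because \<open>real_of_ereal\<close>
  sends infinity to 0.\<close>

lemma Linf_norm_AE:
  assumes "\<theta> \<in> Linf \<Omega>"
  shows "AE x in lebesgue_on \<Omega>. \<bar>\<theta> x\<bar> \<le> Linf_norm \<Omega> \<theta>"
proof -
  have "AE x in lebesgue_on \<Omega>. ereal \<bar>\<theta> x\<bar> \<le> esssup (lebesgue_on \<Omega>) (\<lambda>x. ereal \<bar>\<theta> x\<bar>)"
    by (rule esssup_AE)
  moreover have "esssup (lebesgue_on \<Omega>) (\<lambda>x. ereal \<bar>\<theta> x\<bar>) < \<infinity>"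
    using assms by (simp add: Linf_def)
  ultimately show ?thesis
    unfolding Linf_norm_def
    by (cases "esssup (lebesgue_on \<Omega>) (\<lambda>x. ereal \<bar>\<theta> x\<bar>)") (auto elim: eventually_mono)
qed

text \<open>\<open>A\<close> is the integral of \<open>\<theta>\<^sup>2\<close> times the squared
  norm of \<open>u\<close>, whence its reality, its sign and its bound.\<close>

lemma L2_inner_mult_square:
  assumes \<theta>: "\<theta> \<in> Linf \<Omega>" and u: "u \<in> L2_fields \<Omega>"
  shows "(\<lambda>x. complex_of_real ((\<theta> x)\<^sup>2) *s u x) \<in> L2_fields \<Omega>"
    and "\<exists>A. L2_inner \<Omega> (\<lambda>x. complex_of_real ((\<theta> x)\<^sup>2) *s u x) u = of_real A
      \<and> 0 \<le> A \<and> A \<le> (Linf_norm \<Omega> \<theta>)\<^sup>2 * (L2_norm \<Omega> u)\<^sup>2"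
proof -
  have [measurable]: "\<theta> \<in> borel_measurable (lebesgue_on \<Omega>)" using \<theta> by (simp add: Linf_def)
  have bd: "AE x in lebesgue_on \<Omega>. (\<theta> x)\<^sup>2 \<le> (Linf_norm \<Omega> \<theta>)\<^sup>2"
    using Linf_norm_AE[OF \<theta>] by eventually_elim (metis abs_ge_zero power2_abs power_mono)
  show mem: "(\<lambda>x. complex_of_real ((\<theta> x)\<^sup>2) *s u x) \<in> L2_fields \<Omega>"
    by (rule L2_fields_mult[OF _ _ u, where B = "(Linf_norm \<Omega> \<theta>)\<^sup>2"])
       (use bd in \<open>auto simp: norm_power\<close>)
  let ?h = "\<lambda>x. (\<theta> x)\<^sup>2 * (norm (u x))\<^sup>2"
  have eq: "(\<Sum>j\<in>UNIV. (complex_of_real ((\<theta> x)\<^sup>2) *s u x) $ j * cnj (u x $ j)) = complex_of_real (?h x)" for x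
    using sum_mult_cnj_self[of "u x"]
    by (simp add: mult.assoc flip: sum_distrib_left)
  have "integrable (lebesgue_on \<Omega>) (\<lambda>x. complex_of_real (?h x))"
    using L2_inner_integrable[OF mem u] unfolding eq .
  then have int: "integrable (lebesgue_on \<Omega>) ?h"
    by (simp only: complex_of_real_integrable_eq)
  have "(LINT x|lebesgue_on \<Omega>. ?h x) \<le> (LINT x|lebesgue_on \<Omega>. (Linf_norm \<Omega> \<theta>)\<^sup>2 * (norm (u x))\<^sup>2)"
    by (rule integral_mono_AE[OF int])
       (use L2_fieldsD(2)[OF u] bd in \<open>auto elim!: eventually_mono intro!: mult_right_mono\<close>)
  also have "\<dots> = (Linf_norm \<Omega> \<theta>)\<^sup>2 * (L2_norm \<Omega> u)\<^sup>2"
    by (simp add: L2_norm_sq)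
  finally show "\<exists>A. L2_inner \<Omega> (\<lambda>x. complex_of_real ((\<theta> x)\<^sup>2) *s u x) u = of_real A
      \<and> 0 \<le> A \<and> A \<le> (Linf_norm \<Omega> \<theta>)\<^sup>2 * (L2_norm \<Omega> u)\<^sup>2"
    unfolding L2_inner_def eq by (intro exI[of _ "LINT x|lebesgue_on \<Omega>. ?h x"]) (simp add: integral_complex_of_real del: of_real_mult of_real_power)
qed

lemma Im_divide_shift:
  "Im (of_real A / (\<omega> + \<i> * of_real \<gamma>)) = - A * ((Im \<omega> + \<gamma>) / ((Re \<omega>)\<^sup>2 + (Im \<omega> + \<gamma>)\<^sup>2))"
  by (simp add: Im_divide)

text \<open>\<open>A\<close> and \<open>B\<close> are the forms of the two multiplication operators
  and vary with \<open>U\<close>. Both components of \<open>U\<close> have norm at most 1, so the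
  bounds are uniform.\<close>

lemma Im_maxwell_quadratic_form:
  assumes \<Omega>: "open \<Omega>" and \<theta>: "\<theta>e \<in> Linf \<Omega>" "\<theta>m \<in> Linf \<Omega>"
    and U: "U \<in> maxwell_dom \<Omega>" "sqrt (Re (L2_pair_inner \<Omega> U U)) = 1"
  obtains A B where "0 \<le> A" "A \<le> (Linf_norm \<Omega> \<theta>e)\<^sup>2" "0 \<le> B" "B \<le> (Linf_norm \<Omega> \<theta>m)\<^sup>2"
    "Im (L2_pair_inner \<Omega> (maxwell_pencil \<Omega> \<gamma>e \<gamma>m \<theta>e \<theta>m \<omega> U) U)
      = - Im \<omega> - A * ((Im \<omega> + \<gamma>e) / ((Re \<omega>)\<^sup>2 + (Im \<omega> + \<gamma>e)\<^sup>2))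
        - B * ((Im \<omega> + \<gamma>m) / ((Re \<omega>)\<^sup>2 + (Im \<omega> + \<gamma>m)\<^sup>2))"
proof -
  obtain u v where [simp]: "U = (u, v)" by (cases U)
  have u: "u \<in> H0_curl \<Omega>" and v: "v \<in> H_curl \<Omega>" using U by (auto simp: maxwell_dom_def)
  then have uH: "u \<in> H_curl \<Omega>" by (simp add: H0_curl_def)
  have L2: "u \<in> L2_fields \<Omega>" "v \<in> L2_fields \<Omega>" "curl \<Omega> u \<in> L2_fields \<Omega>" "curl \<Omega> v \<in> L2_fields \<Omega>"
    using uH v curl_works(1) by (auto simp: H_curl_def)
  have norm1: "(L2_norm \<Omega> u)\<^sup>2 + (L2_norm \<Omega> v)\<^sup>2 = 1"
    using U(2) by (simp add: L2_pair_inner_def L2_inner_self)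
  then have le1: "(L2_norm \<Omega> u)\<^sup>2 \<le> 1" "(L2_norm \<Omega> v)\<^sup>2 \<le> 1"
    using zero_le_power2[of "L2_norm \<Omega> u"] zero_le_power2[of "L2_norm \<Omega> v"] by linarith+
  let ?ce = "\<omega> + \<i> * complex_of_real \<gamma>e" and ?cm = "\<omega> + \<i> * complex_of_real \<gamma>m"
  \<comment> \<open>Expands one row of the pencil, with \<open>w\<close> the diagonal component and
    \<open>k\<close> the curl of the other one; it serves both rows.\<close>
  have split: "L2_inner \<Omega> (\<lambda>x. (- \<omega> + complex_of_real ((\<theta> x)\<^sup>2) / c) *s w x + d *s k x) w
      = - \<omega> * L2_inner \<Omega> w w + L2_inner \<Omega> (\<lambda>x. complex_of_real ((\<theta> x)\<^sup>2) *s w x) w / c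
        + d * L2_inner \<Omega> k w"
    if "\<theta> \<in> Linf \<Omega>" "w \<in> L2_fields \<Omega>" "k \<in> L2_fields \<Omega>" for \<theta> c d w k
  proof -
    have "(\<lambda>x. (- \<omega> + complex_of_real ((\<theta> x)\<^sup>2) / c) *s w x + d *s k x)
        = (\<lambda>x. ((- \<omega>) *s w x + (1 / c) *s (complex_of_real ((\<theta> x)\<^sup>2) *s w x)) + d *s k x)"
      by (auto simp: vec_eq_iff field_simps)
    then show ?thesis
      using that L2_inner_mult_square(1)[OF that(1,2)]
      by (simp only: L2_inner_add_left L2_fields_add L2_fields_scale L2_inner_scale_left) simp
  qed
  obtain A where A: "L2_inner \<Omega> (\<lambda>x. complex_of_real ((\<theta>e x)\<^sup>2) *s u x) u = of_real A"
    "0 \<le> A" "A \<le> (Linf_norm \<Omega> \<theta>e)\<^sup>2 * (L2_norm \<Omega> u)\<^sup>2"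
    using L2_inner_mult_square(2)[OF \<theta>(1) L2(1)] by blast
  obtain B where B: "L2_inner \<Omega> (\<lambda>x. complex_of_real ((\<theta>m x)\<^sup>2) *s v x) v = of_real B"
    "0 \<le> B" "B \<le> (Linf_norm \<Omega> \<theta>m)\<^sup>2 * (L2_norm \<Omega> v)\<^sup>2"
    using L2_inner_mult_square(2)[OF \<theta>(2) L2(2)] by blast
  define Z where "Z = L2_inner \<Omega> (curl \<Omega> u) v"
  have Z: "L2_inner \<Omega> (curl \<Omega> v) u = cnj Z"
    using L2_inner_curl_symmetric[OF \<Omega> u v] L2_inner_commute[of \<Omega> v] by (simp add: Z_def)
  have "L2_inner \<Omega> (\<lambda>x. (- \<i>) *s curl \<Omega> u x
        + (- \<omega> + of_real ((\<theta>m x)\<^sup>2) / ?cm) *s v x) v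
      = - \<omega> * L2_inner \<Omega> v v + of_real B / ?cm + (- \<i>) * Z"
    using split[OF \<theta>(2) L2(2,3), of ?cm "- \<i>"] unfolding B(1) Z_def[symmetric]
    by (simp only: add.commute)
  moreover have "L2_inner \<Omega> (\<lambda>x. (- \<omega> + of_real ((\<theta>e x)\<^sup>2) / ?ce) *s u x
        + \<i> *s curl \<Omega> v x) u
      = - \<omega> * L2_inner \<Omega> u u + of_real A / ?ce + \<i> * cnj Z"
    using split[OF \<theta>(1) L2(1,4), of ?ce \<i>] unfolding A(1) Z .
  ultimately have "L2_pair_inner \<Omega> (maxwell_pencil \<Omega> \<gamma>e \<gamma>m \<theta>e \<theta>m \<omega> U) U
    = (- \<omega> * L2_inner \<Omega> u u + of_real A / ?ce + \<i> * cnj Z)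
      + (- \<omega> * L2_inner \<Omega> v v + of_real B / ?cm + (- \<i>) * Z)"
    by (simp only: L2_pair_inner_def maxwell_pencil_def prod.case fst_conv snd_conv \<open>U = (u, v)\<close>)
  \<comment> \<open>The off-diagonal terms combine to \<open>\<i> * cnj Z - \<i> * Z\<close>, which
    is the real number \<open>2 * Im Z\<close>.\<close>
  also have "\<dots> = - \<omega> * of_real ((L2_norm \<Omega> u)\<^sup>2 + (L2_norm \<Omega> v)\<^sup>2)
      + of_real A / ?ce + of_real B / ?cm + of_real (2 * Im Z)"
    by (simp add: L2_inner_self complex_eq_iff algebra_simps)
  also have "\<dots> = - \<omega> + of_real A / ?ce + of_real B / ?cm + of_real (2 * Im Z)"
    by (simp add: norm1)
  finally have "Im (L2_pair_inner \<Omega> (maxwell_pencil \<Omega> \<gamma>e \<gamma>m \<theta>e \<theta>m \<omega> U) U)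
      = - Im \<omega> - A * ((Im \<omega> + \<gamma>e) / ((Re \<omega>)\<^sup>2 + (Im \<omega> + \<gamma>e)\<^sup>2))
        - B * ((Im \<omega> + \<gamma>m) / ((Re \<omega>)\<^sup>2 + (Im \<omega> + \<gamma>m)\<^sup>2))"
    by (simp only: plus_complex.sel uminus_complex.sel Im_divide_shift Im_complex_of_real)
  moreover have "A \<le> (Linf_norm \<Omega> \<theta>e)\<^sup>2" "B \<le> (Linf_norm \<Omega> \<theta>m)\<^sup>2"
    using A(3) B(3) le1 mult_left_mono[OF le1(1), of "(Linf_norm \<Omega> \<theta>e)\<^sup>2"]
      mult_left_mono[OF le1(2), of "(Linf_norm \<Omega> \<theta>m)\<^sup>2"] by simp_all
  ultimately show thesis using that A(2) B(2) by blast
qed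

section \<open>From the quadratic form to the bounds on the spectral parameter\<close>

text \<open>If \<open>b + g\<close> is not positive, neither is the left side. Otherwise
  \<open>b \<le> 0\<close> bounds the numerator by \<open>g\<close>, and the denominator is at least
  \<open>a\<^sup>2\<close>.\<close>

lemma damping_term_bound:
  fixes a b g A T :: real
  assumes "0 \<le> A" "A \<le> T" "b \<le> 0" "0 < g" "a \<noteq> 0"
  shows "A * ((b + g) / (a\<^sup>2 + (b + g)\<^sup>2)) \<le> g * T / a\<^sup>2"
proof (cases "b + g \<le> 0")
  case True
  then have "A * ((b + g) / (a\<^sup>2 + (b + g)\<^sup>2)) \<le> 0"
    using assms(1) by (intro mult_nonneg_nonpos divide_nonpos_nonneg) auto
  also have "0 \<le> g * T / a\<^sup>2" using assms by auto
  finally show ?thesis .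
next
  case False
  have "(b + g) / (a\<^sup>2 + (b + g)\<^sup>2) \<le> g / a\<^sup>2"
    using False assms by (intro frac_le) auto
  then have "A * ((b + g) / (a\<^sup>2 + (b + g)\<^sup>2)) \<le> T * (g / a\<^sup>2)"
    using False assms by (intro mult_mono) auto
  then show ?thesis by (simp add: mult.commute)
qed

theorem proposition2p5:
  fixes \<Omega> :: "(real^3) set" and \<gamma>e \<gamma>m M :: real and \<theta>e \<theta>m :: "real^3 \<Rightarrow> real"
  assumes "lipschitz_domain \<Omega>"
    and "\<gamma>e > 0" and "\<gamma>m > 0"
    and "\<theta>e \<in> Linf \<Omega>" and "\<theta>m \<in> Linf \<Omega>"
    and "AE x in lebesgue_on \<Omega>. \<theta>e x \<ge> 0" and "AE x in lebesgue_on \<Omega>. \<theta>m x \<ge> 0"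
    and "M = max \<gamma>e \<gamma>m"
  shows "pencil_numerical_range \<Omega> \<gamma>e \<gamma>m \<theta>e \<theta>m \<subseteq>
    {\<omega>. 0 \<le> - Im \<omega> \<and>
         - Im \<omega> \<le> (if Re \<omega> = 0 then M
            else min M ((\<gamma>e * (Linf_norm \<Omega> \<theta>e)\<^sup>2 + \<gamma>m * (Linf_norm \<Omega> \<theta>m)\<^sup>2) / (Re \<omega>)\<^sup>2))}"
proof
  fix \<omega> assume \<omega>: "\<omega> \<in> pencil_numerical_range \<Omega> \<gamma>e \<gamma>m \<theta>e \<theta>m"
  have \<Omega>: "open \<Omega>" using assms(1) by (simp add: lipschitz_domain_def)
  let ?a = "Re \<omega>" and ?b = "Im \<omega>"
  let ?Te = "(Linf_norm \<Omega> \<theta>e)\<^sup>2" and ?Tm = "(Linf_norm \<Omega> \<theta>m)\<^sup>2"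
  \<comment> \<open>Zero lies only in the closure, so no single unit vector need annihilate the
    form: \<open>A\<close> and \<open>B\<close> depend on \<epsilon>, and just their bounds are
    uniform.\<close>
  have approx: "\<exists>A B. 0 \<le> A \<and> A \<le> ?Te \<and> 0 \<le> B \<and> B \<le> ?Tm \<and>
      \<bar>- ?b - A * ((?b + \<gamma>e) / (?a\<^sup>2 + (?b + \<gamma>e)\<^sup>2)) - B * ((?b + \<gamma>m) / (?a\<^sup>2 + (?b + \<gamma>m)\<^sup>2))\<bar> < \<epsilon>"
    if "\<epsilon> > 0" for \<epsilon>
  proof -
    obtain U where U: "U \<in> maxwell_dom \<Omega>" "sqrt (Re (L2_pair_inner \<Omega> U U)) = 1"
      "norm (L2_pair_inner \<Omega> (maxwell_pencil \<Omega> \<gamma>e \<gamma>m \<theta>e \<theta>m \<omega> U) U) < \<epsilon>"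
      using \<omega> \<open>\<epsilon> > 0\<close>
      by (auto simp: pencil_numerical_range_def numerical_range_def closure_approachable)
    obtain A B where AB: "0 \<le> A" "A \<le> ?Te" "0 \<le> B" "B \<le> ?Tm"
      "Im (L2_pair_inner \<Omega> (maxwell_pencil \<Omega> \<gamma>e \<gamma>m \<theta>e \<theta>m \<omega> U) U)
        = - ?b - A * ((?b + \<gamma>e) / (?a\<^sup>2 + (?b + \<gamma>e)\<^sup>2)) - B * ((?b + \<gamma>m) / (?a\<^sup>2 + (?b + \<gamma>m)\<^sup>2))"
      by (rule Im_maxwell_quadratic_form[OF \<Omega> assms(4,5) U(1,2)])
    have "\<bar>Im (L2_pair_inner \<Omega> (maxwell_pencil \<Omega> \<gamma>e \<gamma>m \<theta>e \<theta>m \<omega> U) U)\<bar> < \<epsilon>"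
      by (rule le_less_trans[OF abs_Im_le_cmod U(3)])
    then show ?thesis
      unfolding AB(5) using AB(1-4) by (intro exI conjI)
  qed
  \<comment> \<open>For \<open>?b > 0\<close> all three terms are nonpositive, so their sum has
    modulus at least \<open>?b\<close>; taking \<epsilon> = \<open>?b\<close> contradicts
    this.\<close>
  have nonpos: "?b \<le> 0"
  proof (rule ccontr)
    assume "\<not> ?b \<le> 0"
    then have b: "?b > 0" by simp
    then obtain A B where AB: "0 \<le> A" "0 \<le> B"
      "\<bar>- ?b - A * ((?b + \<gamma>e) / (?a\<^sup>2 + (?b + \<gamma>e)\<^sup>2)) - B * ((?b + \<gamma>m) / (?a\<^sup>2 + (?b + \<gamma>m)\<^sup>2))\<bar> < ?b"
      using approx by blast
    have "0 \<le> A * ((?b + \<gamma>e) / (?a\<^sup>2 + (?b + \<gamma>e)\<^sup>2))" "0 \<le> B * ((?b + \<gamma>m) / (?a\<^sup>2 + (?b + \<gamma>m)\<^sup>2))"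
      using AB b assms(2,3) by auto
    then show False using AB(3) by linarith
  qed
  \<comment> \<open>If \<open>- ?b\<close> exceeds \<open>M\<close>, both shifted imaginary parts
    are nonpositive, so every term is nonnegative and the sum is at least \<open>- ?b\<close>; now
    take \<epsilon> = \<open>- ?b\<close>.\<close>
  have leM: "- ?b \<le> M"
  proof (rule ccontr)
    assume "\<not> - ?b \<le> M"
    then have b: "?b + \<gamma>e \<le> 0" "?b + \<gamma>m \<le> 0" "- ?b > 0" using assms by auto
    obtain A B where AB: "0 \<le> A" "0 \<le> B"
      "\<bar>- ?b - A * ((?b + \<gamma>e) / (?a\<^sup>2 + (?b + \<gamma>e)\<^sup>2)) - B * ((?b + \<gamma>m) / (?a\<^sup>2 + (?b + \<gamma>m)\<^sup>2))\<bar> < - ?b"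
      using approx[OF b(3)] by blast
    have "A * ((?b + \<gamma>e) / (?a\<^sup>2 + (?b + \<gamma>e)\<^sup>2)) \<le> 0" "B * ((?b + \<gamma>m) / (?a\<^sup>2 + (?b + \<gamma>m)\<^sup>2)) \<le> 0"
      using AB b by (auto intro!: mult_nonneg_nonpos divide_nonpos_nonneg)
    then show False using AB(3) by linarith
  qed
  have "- ?b \<le> (\<gamma>e * ?Te + \<gamma>m * ?Tm) / ?a\<^sup>2" if a: "?a \<noteq> 0"
  proof (rule field_le_epsilon)
    fix \<epsilon> :: real assume "\<epsilon> > 0"
    then obtain A B where AB: "0 \<le> A" "A \<le> ?Te" "0 \<le> B" "B \<le> ?Tm"
      "\<bar>- ?b - A * ((?b + \<gamma>e) / (?a\<^sup>2 + (?b + \<gamma>e)\<^sup>2)) - B * ((?b + \<gamma>m) / (?a\<^sup>2 + (?b + \<gamma>m)\<^sup>2))\<bar> < \<epsilon>"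
      using approx by blast
    then show "- ?b \<le> (\<gamma>e * ?Te + \<gamma>m * ?Tm) / ?a\<^sup>2 + \<epsilon>"
      using damping_term_bound[OF AB(1,2) nonpos assms(2) a] damping_term_bound[OF AB(3,4) nonpos assms(3) a]
      unfolding add_divide_distrib by linarith
  qed
  then show "\<omega> \<in> {\<omega>. 0 \<le> - Im \<omega> \<and>
         - Im \<omega> \<le> (if Re \<omega> = 0 then M
            else min M ((\<gamma>e * ?Te + \<gamma>m * ?Tm) / (Re \<omega>)\<^sup>2))}"
    using nonpos leM by simp
qed

end
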